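(* Let $r\ge 1$ and $\mu\in\mathcal P_r$, and assume that the inverse measure $\mu^{-1}$ is absolutely continuous with respect to Lebesgue measure $\lambda$ on $]0,1[$. Then $$\lim_{n\to\infty} n\, d_r\big(\delta^{\mathbf u_n}_\bullet,\mu\big)=\frac{1}{2(r+1)^{1/r}}\left(\int_0^1\Big(\frac{{\rm d}\mu^{-1}}{{\rm d}\lambda}(t)\Big)^r{\rm d}t\right)^{1/r},$$ where both sides may equal $+\infty$. Moreover, if $\frac{{\rm d}\mu^{-1}}{{\rm d}\lambda}\in L^r(]0,1[)$ and $\mu$ is not a Dirac measure $\delta_a$ ($a\in\mathbb R$), then the sequence $(\delta^{\mathbf u_n}_{\mathbf x_n})_{n\ge1}$ with $x_{n,i}=F_\mu^{-1}\big(\tfrac{2i-1}{2n}\big)$, $1\le i\le n$, is a sequence of asymptotically best uniform $r$-approximations of $\mu$, i.e. $\lim_{n\to\infty} d_r(\delta^{\mathbf u_n}_{\mathbf x_n},\mu)/d_r(\delta^{\mathbf u_n}_\bullet,\mu)=1$.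
   Context: $\mathcal P$ denotes the set of Borel probability measures on $\mathbb R$; $\mathcal P_r=\{\mu\in\mathcal P:\int|x|^r{\rm d}\mu(x)<\infty\}$ for $r\ge1$. For $\mu\in\mathcal P$, $F_\mu(x)=\mu(]-\infty,x])$ and the (upper) quantile function is $F_\mu^{-1}(t)=\sup\{x\in\mathbb R: F_\mu(x)\le t\}$ for $t\in]0,1[$. The $L^r$-Kantorovich distance on $\mathcal P_r$ is $d_r(\mu,\nu)=\big(\int_0^1|F_\mu^{-1}(t)-F_\nu^{-1}(t)|^r{\rm d}t\big)^{1/r}$. The inverse measure $\mu^{-1}$ is the positive Borel measure on $]0,1[$ with $\mu^{-1}(]t,u])=F_\mu^{-1}(u)-F_\mu^{-1}(t)$ for $0<t<u<1$. Let $\Xi_n=\{\mathbf x\in\mathbb R^n:x_1\le\dots\le x_n\}$, $\Pi_n=\{\mathbf p\in\mathbb R^n:p_i\ge0,\sum_i p_i=1\}$, $\delta^{\mathbf p}_{\mathbf x}=\sum_{i=1}^n p_i\delta_{x_i}$, and $\mathbf u_n=(1/n,\dots,1/n)\in\Pi_n$. A best uniform $r$-approximation $\delta^{\mathbf u_n}_\bullet$ of $\mu$ is any $\delta^{\mathbf u_n}_{\mathbf x}$ with $\mathbf x\in\Xi_n$ minimizing $d_r(\delta^{\mathbf u_n}_{\mathbf x},\mu)$ over $\Xi_n$ (such a minimizer exists); thus $d_r(\delta^{\mathbf u_n}_\bullet,\mu)=\min_{\mathbf x\in\Xi_n}d_r(\delta^{\mathbf u_n}_{\mathbf x},\mu)$.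 *)

theory Defs
  imports "HOL-Probability.Probability"
begin

definition is_borel_prob :: "real measure \<Rightarrow> bool" where
  "is_borel_prob \<mu> \<longleftrightarrow> prob_space \<mu> \<and> sets \<mu> = sets borel"

definition in_P :: "real \<Rightarrow> real measure \<Rightarrow> bool" where
  "in_P r \<mu> \<longleftrightarrow> is_borel_prob \<mu> \<and> (\<integral>\<^sup>+ x. ennreal (\<bar>x\<bar> powr r) \<partial>\<mu>) < \<infinity>"

definition cdf_of :: "real measure \<Rightarrow> real \<Rightarrow> real" where
  "cdf_of \<mu> x = measure \<mu> {..x}"

text \<open>Upper quantile function F_mu^{-1}(t) = sup {x. F_mu x <= t}, meant for 0 < t < 1.\<close>
definition quantile :: "real measure \<Rightarrow> real \<Rightarrow> real" where
  "quantile \<mu> t = Sup {x. cdf_of \<mu> x \<le> t}"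

definition kdist :: "real \<Rightarrow> real measure \<Rightarrow> real measure \<Rightarrow> real" where
  "kdist r \<mu> \<nu> =
     (LINT t:{0<..<1}|lborel. \<bar>quantile \<mu> t - quantile \<nu> t\<bar> powr r) powr (1 / r)"

definition unif_discrete :: "nat \<Rightarrow> (nat \<Rightarrow> real) \<Rightarrow> real measure" where
  "unif_discrete n x = distr (uniform_count_measure {..<n}) borel x"

definition Xi :: "nat \<Rightarrow> (nat \<Rightarrow> real) set" where
  "Xi n = {x. \<forall>i j. i \<le> j \<longrightarrow> j < n \<longrightarrow> x i \<le> x j}"

text \<open>d_r(delta^{u_n}_bullet, mu): the minimal distance over Xi_n (the minimum exists).\<close>
definition best_unif_dist :: "real \<Rightarrow> real measure \<Rightarrow> nat \<Rightarrow> real" where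
  "best_unif_dist r \<mu> n = (INF x\<in>Xi n. kdist r (unif_discrete n x) \<mu>)"

text \<open>g is (a version of) the Radon-Nikodym density d mu^{-1} / d lambda on ]0,1[,
  i.e. mu^{-1}(]t,u]) = F^{-1}(u) - F^{-1}(t) = integral of g over ]t,u] for 0<t<u<1.\<close>
definition inverse_density :: "real measure \<Rightarrow> (real \<Rightarrow> real) \<Rightarrow> bool" where
  "inverse_density \<mu> g \<longleftrightarrow> g \<in> borel_measurable borel \<and> (\<forall>t\<in>{0<..<1}. 0 \<le> g t) \<and>
     (\<forall>t u. 0 < t \<longrightarrow> t < u \<longrightarrow> u < 1 \<longrightarrow>
        ennreal (quantile \<mu> u - quantile \<mu> t) = (\<integral>\<^sup>+ s\<in>{t<..u}. ennreal (g s) \<partial>lborel))"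

end

theory Submission
  imports Defs
begin

text \<open>
  Rescale each cell of length 1/n to (-1/2, 1/2). Then the r-th power of n times the distance
  from a uniform n-point measure to \<open>\<mu>\<close> is an iterated integral, over the cell variable v and over
  t in (0, 1), of difference quotients of the quantile function Q around the midpoint m of the
  cell containing t. Since Q is almost everywhere differentiable with derivative g, these
  quotients converge.

  Lower bound: averaging v with -v and convexity of the r-th power replace the unknown atom by
  half the increment of Q between m - v/n and m + v/n; Fatou's lemma then gives the limit
  constant, whether it is finite or not.

  Upper bound, with atoms at the values Q(m): by Jensen's inequality the integrand is at most the
  mean of \<open>g powr r\<close> over the cell. These means converge almost everywhere and have a constant
  integral, so Fatou's lemma for the difference bounds the limit superior.
\<close>

text \<open>Two obstacles shape the proof. The points at which Q is compared move with the cell of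
  t, and t may lie outside the interval between them; what saves the convergence is that n times
  their distance from t stays bounded. Moreover, the cell means of \<open>g powr r\<close> need not
  have an integrable supremum over n, so dominated convergence is not at hand. Their constant total
  replaces a majorant: Fatou's lemma for mean minus integrand bounds the limit superior, while the
  limit inferior is inherited from the lower bound. The constant is the integral of |v| powr r over
  (-1/2, 1/2), that is \<open>1 / (2 powr r * (r + 1))\<close>; its r-th root is the factor in the
  theorem. Midpoint atoms are asymptotically optimal because both bounds have the limit integrand
  (|v| g(t)) powr r: an atom at the midpoint is compared with a point at distance |v|/n, and half of
  an increment over length 2|v|/n has the same size to first order. Q may be unbounded near 0 and 1,
  so it is only evaluated strictly inside; cell ends are left to the primitive of
  \<open>g powr r\<close>.\<close>

section \<open>Almost everywhere differentiation of indefinite integrals\<close>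

text \<open>The underlying differentiation theorem averages over boxes with lower corner x, which in
  dimension one means intervals to the right of the point. Its exceptional set is null for completed
  Lebesgue measure, and the property passes from there to \<open>lborel\<close>.\<close>

lemma AE_right_Lebesgue_point:
  fixes f :: "real \<Rightarrow> real"
  assumes f: "integrable lborel f"
  shows "AE t in lborel. \<forall>e>0. \<exists>d>0. \<forall>h. 0 < h \<and> h < d \<longrightarrow>
           \<bar>(LINT s:{t..t+h}|lborel. f s) / h - f t\<bar> < e"
proof -
  have si: "set_integrable lborel {a..b} f" for a b
    using set_integrable_subset[of lborel UNIV f "{a..b}"] f by (simp add: set_integrable_def)
  then have "f integrable_on cbox a b" for a b
    using set_borel_integral_eq_integral(1)[of "{a..b}" f] by simp
  from integrable_ccontinuous_explicit[OF this] obtain N where N: "negligible N"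
    and *: "\<And>x e. \<lbrakk>x \<notin> N; 0 < e\<rbrakk> \<Longrightarrow> \<exists>d>0. \<forall>h. 0 < h \<and> h < d \<longrightarrow>
       norm (integral (cbox x (x + h *\<^sub>R One)) f /\<^sub>R h ^ DIM(real) - f x) < e" by blast
  have "AE t in lebesgue. t \<notin> N"
    using N by (metis AE_not_in negligible_iff_null_sets)
  then have "AE t in lborel. t \<notin> N"
    by (metis AE_completion_iff)
  then show ?thesis
  proof (eventually_elim, intro allI impI)
    fix t e :: real assume "t \<notin> N" "0 < e"
    from *[OF this] show "\<exists>d>0. \<forall>h. 0 < h \<and> h < d \<longrightarrow>
           \<bar>(LINT s:{t..t+h}|lborel. f s) / h - f t\<bar> < e"
      using set_borel_integral_eq_integral(2)[OF si] by (auto simp: divide_inverse mult.commute)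
  qed
qed

text \<open>Left averages of f at t are right averages of the reflected function at -t. Only
  increments of F over intervals inside the open set S enter, so f may be a truncation of a density
  that is merely locally integrable.\<close>

lemma AE_DERIV_indefinite_integral:
  fixes f F :: "real \<Rightarrow> real"
  assumes f: "integrable lborel f" and S: "open S"
    and F: "\<And>a b. a < b \<Longrightarrow> {a..b} \<subseteq> S \<Longrightarrow> F b - F a = (LINT s:{a..b}|lborel. f s)"
  shows "AE t in lborel. t \<in> S \<longrightarrow> (F has_real_derivative f t) (at t)"
proof -
  have f': "integrable lborel (\<lambda>s. f (- s))"
    using lborel_integrable_real_affine[OF f, of "-1" 0] by simp
  let ?P = "\<lambda>f t. \<forall>e>0. \<exists>d>0. \<forall>h. 0 < h \<and> h < d \<longrightarrow>
           \<bar>(LINT s:{t..t+h}|lborel. f s) / h - f t\<bar> < e"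
  have "AE t in lborel. ?P (\<lambda>s. f (- s)) t"
    by (rule AE_right_Lebesgue_point[OF f'])
  \<comment> \<open>Lebesgue measure is invariant under reflection; this moves the almost everywhere
    statement from t to -t.\<close>
  then have "AE t in distr lborel borel uminus. ?P (\<lambda>s. f (- s)) t"
    unfolding lborel_distr_uminus .
  from AE_distrD[OF _ this] have "AE t in lborel. ?P (\<lambda>s. f (- s)) (- t)"
    by simp
  with AE_right_Lebesgue_point[OF f] show ?thesis
  proof eventually_elim
    fix t assume R: "?P f t" and L: "?P (\<lambda>s. f (- s)) (- t)"
    have refl: "(LINT s:{-t..-t+h}|lborel. f (- s)) = (LINT s:{t-h..t}|lborel. f s)" for h
    proof -
      have "(LINT s:{t-h..t}|lborel. f s) = (LINT s|lborel. indicator {t-h..t} (-s) *\<^sub>R f (-s))"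
        unfolding set_lebesgue_integral_def
        using lborel_integral_real_affine[of "-1" "\<lambda>s. indicator {t-h..t} s *\<^sub>R f s" 0] by simp
      also have "\<dots> = (LINT s:{-t..-t+h}|lborel. f (- s))"
        unfolding set_lebesgue_integral_def
        by (intro Bochner_Integration.integral_cong refl) (auto simp: indicator_def)
      finally show ?thesis by simp
    qed
    show "t \<in> S \<longrightarrow> (F has_real_derivative f t) (at t)"
    proof
      assume "t \<in> S"
      then obtain \<delta> where \<delta>: "\<delta> > 0" "cball t \<delta> \<subseteq> S"
        using S open_contains_cball by blast
      show "(F has_real_derivative f t) (at t)"
        unfolding DERIV_def LIM_eq
      proof (intro allI impI)
        fix e :: real assume e: "0 < e"
        from R e obtain d1 where d1: "d1 > 0" "\<And>h. 0 < h \<Longrightarrow> h < d1 \<Longrightarrow>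
            \<bar>(LINT s:{t..t+h}|lborel. f s) / h - f t\<bar> < e" by blast
        from L e obtain d2 where d2: "d2 > 0" "\<And>h. 0 < h \<Longrightarrow> h < d2 \<Longrightarrow>
            \<bar>(LINT s:{t-h..t}|lborel. f s) / h - f t\<bar> < e" unfolding refl by auto
        show "\<exists>s>0. \<forall>h. h \<noteq> 0 \<and> norm (h - 0) < s \<longrightarrow> norm ((F (t + h) - F t) / h - f t) < e"
        proof (intro exI[of _ "Min {\<delta>, d1, d2}"] conjI allI impI)
          show "0 < Min {\<delta>, d1, d2}" using \<delta> d1 d2 by simp
          fix h :: real assume h: "h \<noteq> 0 \<and> norm (h - 0) < Min {\<delta>, d1, d2}"
          show "norm ((F (t + h) - F t) / h - f t) < e"
          proof (cases "h > 0")
            case True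
            have "F (t + h) - F t = (LINT s:{t..t+h}|lborel. f s)"
              using True h \<delta>(2) by (intro F) (auto simp: cball_def dist_real_def subset_iff)
            with d1(2)[of h] True h show ?thesis by simp
          next
            case False
            with h have h0: "h < 0" by simp
            have "F t - F (t - - h) = (LINT s:{t- -h..t}|lborel. f s)"
              using h0 h \<delta>(2) by (intro F) (auto simp: cball_def dist_real_def subset_iff)
            moreover have "(F (t + h) - F t) / h = (F t - F (t + h)) / (- h)"
              by (metis minus_diff_eq minus_divide_divide)
            ultimately show ?thesis using d2(2)[of "- h"] h0 h by simp
          qed
        qed
      qed
    qed
  qed
qed

section \<open>Cells of length 1/n: difference quotients and change of variables\<close>

text \<open>The cell is read off from t by the floor instead of being indexed, so that sums over
  cells become integrals over t and limits can be taken for fixed t.\<close>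

definition cell_mid :: "nat \<Rightarrow> real \<Rightarrow> real" where
  "cell_mid n t = (of_int \<lfloor>real n * t\<rfloor> + 1/2) / real n"

lemma cell_mid_measurable [measurable]: "cell_mid n \<in> borel_measurable borel"
  unfolding cell_mid_def by measurable

lemma cell_mid_close:
  assumes "n > 0" "\<bar>\<alpha>\<bar> \<le> 1/2"
  shows "\<bar>real n * (cell_mid n t + \<alpha> / real n - t)\<bar> \<le> 1"
proof -
  have "real n * (cell_mid n t + \<alpha> / real n - t) = of_int \<lfloor>real n * t\<rfloor> + 1/2 + \<alpha> - real n * t"
    using assms by (simp add: cell_mid_def field_simps)
  with assms show ?thesis by linarith
qed

lemma cell_mid_tendsto:
  assumes "\<bar>\<alpha>\<bar> \<le> 1/2"
  shows "(\<lambda>n. cell_mid n t + \<alpha> / real n) \<longlonglongrightarrow> t"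
proof (rule LIM_zero_cancel, rule Lim_null_comparison)
  show "\<forall>\<^sub>F n in sequentially. norm (cell_mid n t + \<alpha> / real n - t) \<le> 1 / real n"
    using eventually_gt_at_top[of 0]
  proof eventually_elim
    case (elim n)
    from cell_mid_close[OF this assms, of t] elim show ?case
      by (simp only: abs_mult real_norm_def pos_le_divide_eq of_nat_0_less_iff abs_of_nat mult.commute)
  qed
  show "(\<lambda>n. 1 / real n) \<longlonglongrightarrow> 0" by (rule lim_1_over_n)
qed

text \<open>With Caratheodory's form F x - F t = q x * (x - t), the scaled increment from a to b
  equals (\<beta> - \<alpha>) * q b + n * (a - t) * (q b - q a). The second term vanishes in the
  limit: its factor n * (a - t) is bounded by 1, and q is continuous at t.\<close>

lemma cell_difference_quotient_tendsto:
  assumes D: "(F has_real_derivative D) (at t)"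
    and \<alpha>: "\<bar>\<alpha>\<bar> \<le> 1/2" and \<beta>: "\<bar>\<beta>\<bar> \<le> 1/2"
  shows "(\<lambda>n. real n * (F (cell_mid n t + \<beta> / real n) - F (cell_mid n t + \<alpha> / real n)))
           \<longlonglongrightarrow> (\<beta> - \<alpha>) * D"
proof -
  from D obtain q where q: "\<And>x. F x - F t = q x * (x - t)" "isCont q t" "q t = D"
    unfolding CARAT_DERIV by blast
  let ?a = "\<lambda>n. cell_mid n t + \<alpha> / real n" and ?b = "\<lambda>n. cell_mid n t + \<beta> / real n"
  have qa: "(\<lambda>n. q (?a n)) \<longlonglongrightarrow> D" and qb: "(\<lambda>n. q (?b n)) \<longlonglongrightarrow> D"
    using isCont_tendsto_compose[OF q(2) cell_mid_tendsto[OF \<alpha>]]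
      isCont_tendsto_compose[OF q(2) cell_mid_tendsto[OF \<beta>]] q(3) by simp_all
  have "(\<lambda>n. real n * (?a n - t) * (q (?b n) - q (?a n))) \<longlonglongrightarrow> 0"
  proof (rule Lim_null_comparison)
    show "\<forall>\<^sub>F n in sequentially. norm (real n * (?a n - t) * (q (?b n) - q (?a n))) \<le> \<bar>q (?b n) - q (?a n)\<bar>"
      using eventually_gt_at_top[of 0]
    proof eventually_elim
      case (elim n)
      from cell_mid_close[OF this \<alpha>, of t] show ?case
        unfolding real_norm_def by (subst abs_mult) (rule mult_left_le_one_le; simp)
    qed
    show "(\<lambda>n. \<bar>q (?b n) - q (?a n)\<bar>) \<longlonglongrightarrow> 0"
      using tendsto_rabs[OF tendsto_diff[OF qb qa]] by simp
  qed
  from tendsto_add[OF tendsto_mult_left[OF qb, of "\<beta> - \<alpha>"] this]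
  have "(\<lambda>n. (\<beta> - \<alpha>) * q (?b n) + real n * (?a n - t) * (q (?b n) - q (?a n))) \<longlonglongrightarrow> (\<beta> - \<alpha>) * D"
    by simp
  then show ?thesis
  proof (rule Lim_transform_eventually)
    show "\<forall>\<^sub>F n in sequentially. (\<beta> - \<alpha>) * q (?b n) + real n * (?a n - t) * (q (?b n) - q (?a n))
        = real n * (F (?b n) - F (?a n))"
      using eventually_gt_at_top[of 0]
    proof eventually_elim
      case (elim n)
      have "F (?b n) - F (?a n) = q (?b n) * (?b n - t) - q (?a n) * (?a n - t)"
        using q(1)[of "?b n"] q(1)[of "?a n"] by simp
      moreover have "\<beta> - \<alpha> = real n * (?b n - ?a n)"
        using elim by (simp add: field_simps)
      ultimately show ?case by (simp only:) (simp add: algebra_simps)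
    qed
  qed
qed

lemma floor_cell_eq:
  assumes "n > 0" "\<bar>v\<bar> < 1/2"
  shows "\<lfloor>real n * ((real i + 1/2 + v) / real n)\<rfloor> = int i"
  using assms by (simp add: floor_unique)

text \<open>The cell boundaries i/n form a finite, hence null, set; each open cell is the image of
  (-1/2, 1/2) under v -> (i + 1/2 + v)/n, which contributes the factor 1/n.\<close>

lemma nn_integral_cells:
  fixes f :: "real \<Rightarrow> ennreal"
  assumes [measurable]: "f \<in> borel_measurable borel" and n: "n > 0"
  shows "(\<integral>\<^sup>+t\<in>{0<..<1}. f t \<partial>lborel) =
    (\<Sum>i<n. ennreal (1 / real n) * (\<integral>\<^sup>+v\<in>{-1/2<..<1/2}. f ((real i + 1/2 + v) / real n) \<partial>lborel))"
proof -
  let ?C = "\<lambda>i. {real i / real n<..<(real i + 1) / real n}"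
  have "finite ((\<lambda>i. real i / real n) ` {..n})" by simp
  then have "AE t in lborel. t \<notin> (\<lambda>i. real i / real n) ` {..n}"
    by (intro AE_not_in finite_imp_null_set_lborel)
  then have "AE t in lborel. f t * indicator {0<..<1} t = (\<Sum>i<n. f t * indicator (?C i) t)"
  proof eventually_elim
    case (elim t)
    show ?case
    proof (cases "t \<in> {0<..<1}")
      case True
      define k where "k = nat \<lfloor>real n * t\<rfloor>"
      have k: "real k \<le> real n * t" "real n * t < real k + 1"
        using True n unfolding k_def by auto
      have "real n * t < real n" using True n by simp
      with k have kn: "k < n" by linarith
      have kt: "t \<noteq> real k / real n" using elim kn by auto
      have "indicator (?C i) t = (if i = k then 1 else 0::ennreal)" if "i < n" for i
      proof -
        have "t \<in> ?C i \<longleftrightarrow> i = k"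
        proof
          assume "t \<in> ?C i"
          then have "real i < real n * t" "real n * t < real i + 1"
            using n by (auto simp: field_simps)
          with k have "real i < real k + 1" "real k < real i + 1" by linarith+
          then show "i = k" by linarith
        next
          assume "i = k"
          with k kt n show "t \<in> ?C i" by (auto simp: field_simps)
        qed
        then show ?thesis by (simp add: indicator_def)
      qed
      then have "(\<Sum>i<n. f t * indicator (?C i) t) = (\<Sum>i<n. if i = k then f t else 0)"
        by (intro sum.cong) auto
      with kn True show ?thesis by simp
    next
      case False
      have "t \<notin> ?C i" if "i < n" for i
      proof
        assume a: "t \<in> ?C i"
        have "(real i + 1) / real n \<le> 1" using that n by simp
        moreover have "0 \<le> real i / real n" by simp
        ultimately have "0 < t" "t < 1" using a
          by (meson greaterThanLessThan_iff le_less_trans less_le_trans)+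
        with False show False by simp
      qed
      with False show ?thesis by simp
    qed
  qed
  then have "(\<integral>\<^sup>+t\<in>{0<..<1}. f t \<partial>lborel) = (\<integral>\<^sup>+t. (\<Sum>i<n. f t * indicator (?C i) t) \<partial>lborel)"
    by (rule nn_integral_cong_AE)
  also have "\<dots> = (\<Sum>i<n. \<integral>\<^sup>+t\<in>?C i. f t \<partial>lborel)"
    by (rule nn_integral_sum) measurable
  also have "\<dots> = (\<Sum>i<n. ennreal (1 / real n) * (\<integral>\<^sup>+v\<in>{-1/2<..<1/2}. f ((real i + 1/2 + v) / real n) \<partial>lborel))"
  proof (rule sum.cong[OF refl])
    fix i
    have eq: "(real i + 1/2) / real n + 1 / real n * v = (real i + 1/2 + v) / real n" for v
      by (simp add: add_divide_distrib)
    have ind: "indicator (?C i) ((real i + 1/2 + v) / real n) = (indicator {-1/2<..<1/2} v :: ennreal)" for v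
      using n by (auto simp: indicator_def field_simps)
    show "(\<integral>\<^sup>+t\<in>?C i. f t \<partial>lborel) =
       ennreal (1 / real n) * (\<integral>\<^sup>+v\<in>{-1/2<..<1/2}. f ((real i + 1/2 + v) / real n) \<partial>lborel)"
      using nn_integral_real_affine[of "\<lambda>t. f t * indicator (?C i) t" "1 / real n" "(real i + 1/2) / real n"] n
      unfolding eq ind by simp
  qed
  finally show ?thesis .
qed

text \<open>This makes the position v inside a cell an independent outer variable: for fixed v the
  inner integrand can converge for almost every t. Both sides equal the same sum over cells. The
  cell index is a separate argument of f because an atom depends on the cell only, and Q on the
  point.\<close>

lemma nn_integral_cells_swap:
  fixes f :: "int \<Rightarrow> real \<Rightarrow> ennreal"
  assumes f [measurable]: "\<And>i. f i \<in> borel_measurable borel" and n: "n > 0"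
  shows "(\<integral>\<^sup>+t\<in>{0<..<1}. f \<lfloor>real n * t\<rfloor> t \<partial>lborel) =
    (\<integral>\<^sup>+v\<in>{-1/2<..<1/2}. (\<integral>\<^sup>+t\<in>{0<..<1}. f \<lfloor>real n * t\<rfloor> (cell_mid n t + v / real n) \<partial>lborel) \<partial>lborel)"
proof -
  have fl: "(\<integral>\<^sup>+v\<in>{-1/2<..<1/2}. h \<lfloor>real n * ((real i + 1/2 + v) / real n)\<rfloor> v \<partial>lborel) =
      (\<integral>\<^sup>+v\<in>{-1/2<..<1/2}. h (int i) v \<partial>lborel)" for h :: "int \<Rightarrow> real \<Rightarrow> ennreal" and i
  proof (rule nn_integral_cong)
    fix v :: real
    show "h \<lfloor>real n * ((real i + 1/2 + v) / real n)\<rfloor> v * indicator {-1/2<..<1/2} v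
        = h (int i) v * indicator {-1/2<..<1/2} v"
    proof (cases "v \<in> {-1/2<..<1/2}")
      case True
      then have "\<bar>v\<bar> < 1/2" by auto
      from floor_cell_eq[OF n this, of i] show ?thesis by simp
    qed simp
  qed
  have L: "(\<integral>\<^sup>+t\<in>{0<..<1}. f \<lfloor>real n * t\<rfloor> t \<partial>lborel) =
    (\<Sum>i<n. ennreal (1 / real n) * (\<integral>\<^sup>+v\<in>{-1/2<..<1/2}. f i ((real i + 1/2 + v) / real n) \<partial>lborel))"
    by (subst nn_integral_cells[OF _ n])
      (simp_all only: fl[of "\<lambda>k v. f k ((real _ + 1/2 + v) / real n)"], measurable)
  have R: "(\<integral>\<^sup>+t\<in>{0<..<1}. f \<lfloor>real n * t\<rfloor> (cell_mid n t + v / real n) \<partial>lborel) =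
    (\<Sum>i<n. ennreal (1 / real n) * f i ((real i + 1/2 + v) / real n))" for v
  proof -
    \<comment> \<open>The integrand depends on t only through the floor, so on each cell a constant
      is integrated over an interval of rescaled length 1.\<close>
    have "(\<integral>\<^sup>+t\<in>{0<..<1}. f \<lfloor>real n * t\<rfloor> (cell_mid n t + v / real n) \<partial>lborel) =
      (\<Sum>i<n. ennreal (1 / real n) * (\<integral>\<^sup>+w\<in>{-1/2<..<1/2::real}. f i ((real_of_int (int i) + 1/2) / real n + v / real n) \<partial>lborel))"
      unfolding cell_mid_def
      by (subst nn_integral_cells[OF _ n])
        (simp_all only: fl[of "\<lambda>k w. f k ((real_of_int k + 1/2) / real n + v / real n)"], measurable)
    then show ?thesis by (simp add: nn_integral_cmult_indicator add_divide_distrib)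
  qed
  have "(\<integral>\<^sup>+v\<in>{-1/2<..<1/2}. (\<integral>\<^sup>+t\<in>{0<..<1}. f \<lfloor>real n * t\<rfloor> (cell_mid n t + v / real n) \<partial>lborel) \<partial>lborel)
     = (\<integral>\<^sup>+v. (\<Sum>i<n. ennreal (1 / real n) * (f i ((real i + 1/2 + v) / real n) * indicator {-1/2<..<1/2} v)) \<partial>lborel)"
    unfolding R by (simp add: sum_distrib_right mult.assoc)
  also have "\<dots> = (\<integral>\<^sup>+t\<in>{0<..<1}. f \<lfloor>real n * t\<rfloor> t \<partial>lborel)"
    unfolding L by (subst nn_integral_sum) (measurable, simp add: nn_integral_cmult)
  finally show ?thesis by simp
qed

section \<open>Convexity of the r-th power and the limit constant\<close>

text \<open>Convexity on the open half line covers a, y > 0. At y = 0 the left side is 0, since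
  \<open>0 powr s = 0\<close> for every exponent; at a = 0 the claim reduces to 1 <= r. The boundary
  value a = 0 is needed in the Jensen argument, where g is replaced by 0 on part of a cell.\<close>

lemma powr_above_tangent:
  fixes a y r :: real
  assumes "r \<ge> 1" "a \<ge> 0" "y \<ge> 0"
  shows "y powr r + r * y powr (r - 1) * (a - y) \<le> a powr r"
proof (cases "y = 0")
  case False
  with assms have y: "y > 0" by simp
  have yr: "y powr (r - 1) * y = y powr r" using y by (simp add: powr_mult_base mult.commute)
  show ?thesis
  proof (cases "a = 0")
    case True
    have "y powr r \<le> r * (y powr (r - 1) * y)"
      unfolding yr using assms mult_right_mono[of 1 r "y powr r"] by simp
    with True show ?thesis by (simp add: mult.assoc)
  next
    case False
    with assms have a: "a > 0" by simp
    have "r * y powr (r - 1) * (a - y) \<le> a powr r - y powr r"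
      by (rule convex_on_imp_above_tangent[OF powr_convex[OF assms(1)]])
        (use a y in \<open>auto intro!: derivative_eq_intros simp: interior_open at_within_open[of y "{0<..}"]\<close>)
    then show ?thesis by simp
  qed
qed (use assms in simp)

text \<open>Add the tangent bounds at the midpoint for both end points; the linear terms
  cancel.\<close>

lemma powr_midpoint_le:
  fixes a b r :: real
  assumes "r \<ge> 1" "a \<ge> 0" "b \<ge> 0"
  shows "2 * ((a + b) / 2) powr r \<le> a powr r + b powr r"
proof -
  have eq: "c * (a - (a + b) / 2) + c * (b - (a + b) / 2) = 0" for c :: real
    by (simp add: algebra_simps add_divide_distrib)
  show ?thesis
    using powr_above_tangent[OF assms(1,2), of "(a + b) / 2"]
      powr_above_tangent[OF assms(1,3), of "(a + b) / 2"]
      eq[of "r * ((a + b) / 2) powr (r - 1)"] assms by simp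
qed

text \<open>Each half of the interval contributes (1/2) powr (r + 1) / (r + 1).\<close>

lemma nn_integral_abs_powr_symmetric:
  fixes r :: real assumes "r \<ge> 1"
  shows "(\<integral>\<^sup>+v\<in>{-1/2<..<1/2}. ennreal (\<bar>v\<bar> powr r) \<partial>lborel) = ennreal (1 / (2 powr r * (r + 1)))"
proof -
  let ?h = "\<integral>\<^sup>+v\<in>{0..1/2}. ennreal (\<bar>v\<bar> powr r) \<partial>lborel"
  have "((\<lambda>v. v powr r) has_integral ((1/2) powr (r + 1) / (r + 1))) {0..1/2}"
    using assms by (intro has_integral_powr_from_0) auto
  then have "((\<lambda>v. \<bar>v\<bar> powr r) has_integral ((1/2) powr (r + 1) / (r + 1))) {0..1/2}"
    by (subst has_integral_cong[where g="\<lambda>v. v powr r"]) auto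
  then have "((\<lambda>v. \<bar>v\<bar> powr r * indicator {0..1/2} v) has_integral ((1/2) powr (r + 1) / (r + 1))) UNIV"
    by (subst (asm) has_integral_restrict_UNIV[symmetric])
      (erule has_integral_cong[THEN iffD1, rotated], auto simp: indicator_def)
  from nn_integral_has_integral_lborel[OF _ _ this]
  have h: "?h = ennreal ((1/2) powr (r + 1) / (r + 1))"
    by (simp add: ennreal_mult' ennreal_indicator)
  have "(\<integral>\<^sup>+v\<in>{-1/2..0}. ennreal (\<bar>v\<bar> powr r) \<partial>lborel) = ?h"
    by (subst nn_integral_real_affine[where c="-1" and t=0])
      (auto intro!: nn_integral_cong simp: indicator_def)
  moreover have "(\<integral>\<^sup>+v\<in>{-1/2<..<1/2}. ennreal (\<bar>v\<bar> powr r) \<partial>lborel) =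
     (\<integral>\<^sup>+v. ennreal (\<bar>v\<bar> powr r) * indicator {-1/2..0} v + ennreal (\<bar>v\<bar> powr r) * indicator {0..1/2} v \<partial>lborel)"
  proof (rule nn_integral_cong_AE)
    show "AE v in lborel. ennreal (\<bar>v\<bar> powr r) * indicator {-1/2<..<1/2} v
       = ennreal (\<bar>v\<bar> powr r) * indicator {-1/2..0} v + ennreal (\<bar>v\<bar> powr r) * indicator {0..1/2} v"
      using AE_lborel_singleton[of "0::real"] AE_lborel_singleton[of "1/2::real"] AE_lborel_singleton[of "-1/2::real"]
      by eventually_elim (auto simp: indicator_def)
  qed
  ultimately have "(\<integral>\<^sup>+v\<in>{-1/2<..<1/2}. ennreal (\<bar>v\<bar> powr r) \<partial>lborel) = ?h + ?h"
    by (simp add: nn_integral_add)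
  also have "\<dots> = ennreal (1 / (2 powr r * (r + 1)))"
    unfolding h using assms
    by (subst ennreal_plus[symmetric]) (auto simp: powr_add powr_divide)
  finally show ?thesis .
qed

section \<open>Limits of iterated integrals\<close>

text \<open>Fatou's lemma is applied in t for each fixed v, then in v. The exceptional null set of t
  may depend on v, as it does when the convergence is checked one v at a time.\<close>

lemma nested_Fatou:
  fixes \<phi> :: "nat \<Rightarrow> real \<Rightarrow> real \<Rightarrow> ennreal"
  assumes [measurable]: "\<And>n. case_prod (\<phi> n) \<in> borel_measurable (borel \<Otimes>\<^sub>M borel)"
    and U [measurable]: "U \<in> sets borel" "V \<in> sets borel"
    and lim: "\<And>v. v \<in> V \<Longrightarrow> AE t in lborel. t \<in> U \<longrightarrow> (\<lambda>n. \<phi> n v t) \<longlonglongrightarrow> \<psi> v t"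
  shows "(\<integral>\<^sup>+v\<in>V. (\<integral>\<^sup>+t\<in>U. \<psi> v t \<partial>lborel) \<partial>lborel)
       \<le> liminf (\<lambda>n. \<integral>\<^sup>+v\<in>V. (\<integral>\<^sup>+t\<in>U. \<phi> n v t \<partial>lborel) \<partial>lborel)"
proof -
  have [measurable]: "case_prod (\<phi> n) \<in> borel_measurable (lborel \<Otimes>\<^sub>M lborel)" for n
    using assms(1)[of n] by (simp cong: measurable_cong_sets sets_pair_measure_cong)
  have "(\<integral>\<^sup>+v\<in>V. (\<integral>\<^sup>+t\<in>U. \<psi> v t \<partial>lborel) \<partial>lborel)
     \<le> (\<integral>\<^sup>+v. liminf (\<lambda>n. (\<integral>\<^sup>+t\<in>U. \<phi> n v t \<partial>lborel) * indicator V v) \<partial>lborel)"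
  proof (rule nn_integral_mono)
    fix v
    show "(\<integral>\<^sup>+t\<in>U. \<psi> v t \<partial>lborel) * indicator V v
      \<le> liminf (\<lambda>n. (\<integral>\<^sup>+t\<in>U. \<phi> n v t \<partial>lborel) * indicator V v)"
    proof (cases "v \<in> V")
      case True
      have "(\<integral>\<^sup>+t\<in>U. \<psi> v t \<partial>lborel) = (\<integral>\<^sup>+t. liminf (\<lambda>n. \<phi> n v t * indicator U t) \<partial>lborel)"
      proof (rule nn_integral_cong_AE)
        show "AE t in lborel. \<psi> v t * indicator U t = liminf (\<lambda>n. \<phi> n v t * indicator U t)"
          using lim[OF True]
          by eventually_elim (auto simp: indicator_def lim_imp_Liminf Liminf_const)
      qed
      also have "\<dots> \<le> liminf (\<lambda>n. \<integral>\<^sup>+t\<in>U. \<phi> n v t \<partial>lborel)"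
        by (rule nn_integral_liminf) measurable
      finally show ?thesis using True by simp
    qed simp
  qed
  also have "\<dots> \<le> liminf (\<lambda>n. \<integral>\<^sup>+v\<in>V. (\<integral>\<^sup>+t\<in>U. \<phi> n v t \<partial>lborel) \<partial>lborel)"
    by (rule nn_integral_liminf) measurable
  finally show ?thesis .
qed

text \<open>Stated as a sum because subtraction in \<open>ennreal\<close> cannot be undone when an
  integral is infinite; for the integrands, f <= e makes the real subtraction harmless.\<close>

lemma nested_nn_integral_diff:
  fixes e :: "real \<Rightarrow> real" and f :: "real \<Rightarrow> real \<Rightarrow> real"
  assumes [measurable]: "e \<in> borel_measurable borel" "case_prod f \<in> borel_measurable (borel \<Otimes>\<^sub>M borel)"
    and U [measurable]: "U \<in> sets borel" "V \<in> sets borel"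
    and f: "\<And>v t. v \<in> V \<Longrightarrow> t \<in> U \<Longrightarrow> 0 \<le> f v t" "\<And>v t. v \<in> V \<Longrightarrow> t \<in> U \<Longrightarrow> f v t \<le> e t"
  shows "(\<integral>\<^sup>+v\<in>V. (\<integral>\<^sup>+t\<in>U. ennreal (e t - f v t) \<partial>lborel) \<partial>lborel)
       + (\<integral>\<^sup>+v\<in>V. (\<integral>\<^sup>+t\<in>U. ennreal (f v t) \<partial>lborel) \<partial>lborel)
       = (\<integral>\<^sup>+v\<in>V. (\<integral>\<^sup>+t\<in>U. ennreal (e t) \<partial>lborel) \<partial>lborel)"
proof -
  have "(\<integral>\<^sup>+t\<in>U. ennreal (e t - f v t) \<partial>lborel) * indicator V v
      + (\<integral>\<^sup>+t\<in>U. ennreal (f v t) \<partial>lborel) * indicator V v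
      = (\<integral>\<^sup>+t\<in>U. ennreal (e t) \<partial>lborel) * indicator V v" for v
  proof (cases "v \<in> V")
    case True
    have "ennreal (e t - f v t) * indicator U t + ennreal (f v t) * indicator U t
        = ennreal (e t) * indicator U t" for t
      using f[OF True, of t] by (cases "t \<in> U") (simp_all flip: ennreal_plus)
    then show ?thesis using True
      by (subst distrib_right[symmetric], subst nn_integral_add[symmetric]) simp_all
  qed simp
  then show ?thesis by (subst nn_integral_add[symmetric]) simp_all
qed

text \<open>Since A + P is eventually a + k, a lower bound for the limit inferior of A is an upper
  bound for the limit superior of P. The hypotheses are in \<open>ennreal\<close>, where Fatou's
  lemma delivers them; the conclusion is real.\<close>

lemma tendsto_of_complementary_liminf:
  fixes A P :: "nat \<Rightarrow> real"
  assumes A: "ennreal a \<le> liminf (\<lambda>n. ennreal (A n))" and P: "ennreal k \<le> liminf (\<lambda>n. ennreal (P n))"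
    and eq: "eventually (\<lambda>n. A n + P n = a + k) sequentially"
    and nn: "\<And>n. 0 \<le> A n" "\<And>n. 0 \<le> P n"
  shows "P \<longlonglongrightarrow> k"
proof -
  \<comment> \<open>\<open>ennreal\<close> sends negative reals to 0, so y < 0 is settled separately
    by the sign of B.\<close>
  have below: "eventually (\<lambda>n. y < B n) sequentially"
    if "ennreal b \<le> liminf (\<lambda>n. ennreal (B n))" "y < b" "\<And>n. 0 \<le> B n" for y b and B :: "nat \<Rightarrow> real"
  proof (cases "y < 0")
    case True
    with that(3) have "y < B n" for n by (meson less_le_trans)
    then show ?thesis by simp
  next
    case False
    with that(2) have "ennreal y < ennreal b" by (simp add: ennreal_less_iff)
    with that(1) have "eventually (\<lambda>n. ennreal y < ennreal (B n)) sequentially"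
      by (auto simp: le_Liminf_iff)
    then show ?thesis using False by (auto simp: ennreal_less_iff)
  qed
  show ?thesis
  proof (rule order_tendstoI)
    fix y assume "y < k"
    from below[OF P this nn(2)] show "eventually (\<lambda>n. y < P n) sequentially" .
  next
    fix y assume "k < y"
    then have "a - (y - k) < a" by simp
    from below[OF A this nn(1)] eq show "eventually (\<lambda>n. P n < y) sequentially"
      by eventually_elim linarith
  qed
qed

section \<open>A monotone function on the unit interval with density g\<close>

text \<open>Q models a quantile function cut off outside ]0,1[; its values at 0 and 1 carry no
  information. The increment equation makes g integrable on compact subintervals, but possibly not
  on ]0,1[.\<close>

locale unit_interval_density =
  fixes Q g :: "real \<Rightarrow> real"
  assumes Q_measurable [measurable]: "Q \<in> borel_measurable borel"
    and g_measurable [measurable]: "g \<in> borel_measurable borel"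
    and g_nonneg: "\<And>t. 0 < t \<Longrightarrow> t < 1 \<Longrightarrow> 0 \<le> g t"
    and Q_mono: "\<And>t u. 0 < t \<Longrightarrow> t \<le> u \<Longrightarrow> u < 1 \<Longrightarrow> Q t \<le> Q u"
    and Q_increment: "\<And>t u. 0 < t \<Longrightarrow> t < u \<Longrightarrow> u < 1 \<Longrightarrow>
      ennreal (Q u - Q t) = (\<integral>\<^sup>+s\<in>{t<..u}. ennreal (g s) \<partial>lborel)"
begin

lemma g_integral_increment:
  assumes "0 < c" "c < d" "d < 1"
  shows "has_bochner_integral lborel (\<lambda>s. g s * indicator {c<..d} s) (Q d - Q c)"
proof (rule has_bochner_integral_nn_integral)
  show "AE s in lborel. 0 \<le> g s * indicator {c<..d} s"
    using assms g_nonneg by (auto simp: indicator_def)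
  show "(\<integral>\<^sup>+s. ennreal (g s * indicator {c<..d} s) \<partial>lborel) = ennreal (Q d - Q c)"
    unfolding Q_increment[OF assms] by (intro nn_integral_cong) (auto simp: indicator_def)
  show "0 \<le> Q d - Q c" using Q_mono[of c d] assms by simp
qed measurable

text \<open>As g may fail to be integrable near 0 and 1, it is truncated to an exhausting sequence
  of intervals; countably many null sets are then discarded at once.\<close>

lemma AE_DERIV_Q: "AE t in lborel. t \<in> {0<..<1} \<longrightarrow> (Q has_real_derivative g t) (at t)"
proof -
  \<comment> \<open>The summand 3 keeps the interval nondegenerate already for k = 0, where it is
    ]1/3, 2/3[.\<close>
  let ?e = "\<lambda>k::nat. 1 / (real k + 3)"
  let ?S = "\<lambda>k. {?e k<..<1 - ?e k}"
  have "AE t in lborel. t \<in> ?S k \<longrightarrow> (Q has_real_derivative g t) (at t)" for k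
  proof -
    let ?f = "\<lambda>s. g s * indicator {?e k<..1 - ?e k} s"
    have e: "0 < ?e k" "?e k < 1 - ?e k" "1 - ?e k < 1" by (auto simp: field_simps)
    have "AE t in lborel. t \<in> ?S k \<longrightarrow> (Q has_real_derivative ?f t) (at t)"
    proof (rule AE_DERIV_indefinite_integral)
      show "integrable lborel ?f"
        using g_integral_increment[OF e] by (simp add: has_bochner_integral_iff)
      fix a b :: real assume ab: "a < b" "{a..b} \<subseteq> ?S k"
      then have "a \<in> {a..b}" "b \<in> {a..b}" by simp_all
      with ab(2) have "a \<in> ?S k" "b \<in> ?S k" by blast+
      then have ab'': "?e k < a" "b < 1 - ?e k" by auto
      note ab' = less_trans[OF e(1) ab''(1)] less_trans[OF ab''(2) e(3)] ab''
      have "(LINT s:{a..b}|lborel. ?f s) = (LINT s|lborel. g s * indicator {a<..b} s)"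
        unfolding set_lebesgue_integral_def
      proof (rule integral_cong_AE)
        show "AE s in lborel. indicator {a..b} s *\<^sub>R ?f s = g s * indicator {a<..b} s"
          using AE_lborel_singleton[of a]
          by eventually_elim (use ab' in \<open>auto simp: indicator_def\<close>)
      qed measurable
      then show "Q b - Q a = (LINT s:{a..b}|lborel. ?f s)"
        using g_integral_increment[OF ab'(1) ab(1) ab'(2)] by (simp add: has_bochner_integral_iff)
    qed simp
    then show ?thesis by eventually_elim (auto simp: indicator_def)
  qed
  then have "AE t in lborel. \<forall>k. t \<in> ?S k \<longrightarrow> (Q has_real_derivative g t) (at t)"
    unfolding AE_all_countable by blast
  then show ?thesis
  proof (eventually_elim, intro impI)
    fix t :: real assume *: "\<forall>k. t \<in> ?S k \<longrightarrow> (Q has_real_derivative g t) (at t)" and t: "t \<in> {0<..<1}"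
    then have "0 < min t (1 - t)" by simp
    from reals_Archimedean[OF this] obtain k where "inverse (real (Suc k)) < min t (1 - t)" by blast
    moreover have "?e k \<le> inverse (real (Suc k))" by (simp add: field_simps)
    ultimately have "t \<in> ?S k" by simp
    with * show "(Q has_real_derivative g t) (at t)" by blast
  qed
qed

text \<open>Strictness matters: in the outermost cells the values -1/2 and 1/2 of v would lead to 0
  and 1, where nothing is known about Q.\<close>

lemma cell_points_in_unit:
  assumes "n > 0" "t \<in> {0<..<1}" "\<bar>v\<bar> < 1/2"
  shows "0 < cell_mid n t + v / real n" "cell_mid n t + v / real n < 1"
proof -
  have "0 \<le> \<lfloor>real n * t\<rfloor>" using assms by simp
  moreover have "\<lfloor>real n * t\<rfloor> < int n" using assms by (simp add: floor_less_iff)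
  ultimately have "0 \<le> real_of_int \<lfloor>real n * t\<rfloor>" "real_of_int \<lfloor>real n * t\<rfloor> + 1 \<le> real n"
    by linarith+
  moreover have "real n * (cell_mid n t + v / real n) = of_int \<lfloor>real n * t\<rfloor> + 1/2 + v"
    using assms(1) by (simp add: cell_mid_def field_simps)
  ultimately have "0 < real n * (cell_mid n t + v / real n)" "real n * (cell_mid n t + v / real n) < real n * 1"
    using assms(3) by linarith+
  with assms show "0 < cell_mid n t + v / real n" "cell_mid n t + v / real n < 1"
    by (auto simp: zero_less_mult_iff)
qed

section \<open>Scaled errors and the lower bound\<close>

text \<open>For sorted x this is the r-th power of n times the distance, as the i-th atom serves the
  i-th cell. It is kept in \<open>ennreal\<close> so that Fatou's lemma applies before finiteness is
  known.\<close>

definition mean_power :: "real \<Rightarrow> nat \<Rightarrow> (nat \<Rightarrow> real) \<Rightarrow> ennreal" where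
  "mean_power r n x =
     (\<integral>\<^sup>+t\<in>{0<..<1}. ennreal ((real n * \<bar>x (nat \<lfloor>real n * t\<rfloor>) - Q t\<bar>) powr r) \<partial>lborel)"

text \<open>No atoms occur here, which makes it a lower bound for all choices of x
  simultaneously.\<close>

definition sym_mean_power :: "real \<Rightarrow> nat \<Rightarrow> ennreal" where
  "sym_mean_power r n = (\<integral>\<^sup>+v\<in>{-1/2<..<1/2}. (\<integral>\<^sup>+t\<in>{0<..<1}.
     ennreal ((real n * \<bar>Q (cell_mid n t + v / real n) - Q (cell_mid n t - v / real n)\<bar> / 2) powr r) \<partial>lborel) \<partial>lborel)"

definition g_power :: "real \<Rightarrow> ennreal" where
  "g_power r = (\<integral>\<^sup>+t\<in>{0<..<1}. ennreal (g t powr r) \<partial>lborel)"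

lemma mean_power_cells:
  assumes "n > 0"
  shows "mean_power r n x = (\<integral>\<^sup>+v\<in>{-1/2<..<1/2}. (\<integral>\<^sup>+t\<in>{0<..<1}.
     ennreal ((real n * \<bar>x (nat \<lfloor>real n * t\<rfloor>) - Q (cell_mid n t + v / real n)\<bar>) powr r) \<partial>lborel) \<partial>lborel)"
  unfolding mean_power_def
  by (rule nn_integral_cells_swap[OF _ assms, of "\<lambda>i s. ennreal ((real n * \<bar>x (nat i) - Q s\<bar>) powr r)"])
    measurable

text \<open>By the triangle inequality through the atom, half the increment of Q is at most the mean
  of the two errors at v and -v; midpoint convexity then bounds its r-th power by the mean of their
  r-th powers.\<close>

lemma sym_mean_power_le_mean_power:
  assumes r: "r \<ge> 1" and n: "n > 0"
  shows "sym_mean_power r n \<le> mean_power r n x"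
proof -
  let ?V = "{-1/2<..<1/2::real}" and ?U = "{0<..<1::real}"
  let ?p = "\<lambda>v t. ennreal ((real n * \<bar>x (nat \<lfloor>real n * t\<rfloor>) - Q (cell_mid n t + v / real n)\<bar>) powr r)"
  let ?s = "\<lambda>v t. ennreal ((real n * \<bar>Q (cell_mid n t + v / real n) - Q (cell_mid n t - v / real n)\<bar> / 2) powr r)"
  have [measurable]: "(\<lambda>t. x (nat \<lfloor>real n * t\<rfloor>)) \<in> borel_measurable borel"
    by (rule measurable_compose_countable[where f="\<lambda>i t. x (nat i)"]) measurable
  have pt: "2 * ?s v t \<le> ?p v t + ?p (- v) t" for v t
  proof -
    let ?y = "x (nat \<lfloor>real n * t\<rfloor>)" and ?a = "Q (cell_mid n t + v / real n)" and ?b = "Q (cell_mid n t - v / real n)"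
    have "2 * (real n * \<bar>?a - ?b\<bar> / 2) powr r
      \<le> 2 * ((real n * \<bar>?y - ?a\<bar> + real n * \<bar>?y - ?b\<bar>) / 2) powr r"
      using r by (intro mult_left_mono powr_mono2) (auto simp flip: distrib_left intro!: mult_left_mono)
    also have "\<dots> \<le> (real n * \<bar>?y - ?a\<bar>) powr r + (real n * \<bar>?y - ?b\<bar>) powr r"
      by (rule powr_midpoint_le[OF r]) auto
    finally have "ennreal (2 * (real n * \<bar>?a - ?b\<bar> / 2) powr r)
      \<le> ennreal ((real n * \<bar>?y - ?a\<bar>) powr r + (real n * \<bar>?y - ?b\<bar>) powr r)"
      by (rule ennreal_leI)
    then show ?thesis by (simp add: ennreal_mult')
  qed
  define h where "h v = (\<integral>\<^sup>+t\<in>?U. ?p v t \<partial>lborel)" for v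
  have [measurable]: "h \<in> borel_measurable borel" unfolding h_def by measurable
  have P: "mean_power r n x = (\<integral>\<^sup>+v\<in>?V. h v \<partial>lborel)"
    unfolding h_def by (rule mean_power_cells[OF n])
  \<comment> \<open>The interval of v is symmetric, so both error terms integrate to the same value
    and the factor 2 cancels.\<close>
  have P': "mean_power r n x = (\<integral>\<^sup>+v\<in>?V. h (- v) \<partial>lborel)"
    unfolding P
    by (subst nn_integral_real_affine[where c="-1" and t=0])
      (auto intro!: nn_integral_cong simp: indicator_def)
  have "2 * sym_mean_power r n = (\<integral>\<^sup>+v\<in>?V. (\<integral>\<^sup>+t\<in>?U. 2 * ?s v t \<partial>lborel) \<partial>lborel)"
    unfolding sym_mean_power_def
    by (simp add: nn_integral_cmult mult.assoc)
  also have "\<dots> \<le> (\<integral>\<^sup>+v\<in>?V. (\<integral>\<^sup>+t\<in>?U. ?p v t + ?p (- v) t \<partial>lborel) \<partial>lborel)"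
    by (intro nn_integral_mono mult_right_mono pt) auto
  also have "\<dots> = (\<integral>\<^sup>+v\<in>?V. h v + h (- v) \<partial>lborel)"
    unfolding h_def by (subst nn_integral_add[symmetric]) (auto simp: distrib_right)
  also have "\<dots> = mean_power r n x + mean_power r n x"
    unfolding distrib_right
    by (subst nn_integral_add) (measurable, simp only: P[symmetric] P'[symmetric])
  finally have "2 * sym_mean_power r n \<le> 2 * mean_power r n x" by (simp add: mult_2)
  then show ?thesis by (simp add: ennreal_mult_le_mult_iff)
qed

lemma integral_scaled_g_power:
  assumes r: "r \<ge> 1"
  shows "(\<integral>\<^sup>+v\<in>{-1/2<..<1/2}. (\<integral>\<^sup>+t\<in>{0<..<1}. ennreal ((\<bar>v\<bar> * g t) powr r) \<partial>lborel) \<partial>lborel)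
     = ennreal (1 / (2 powr r * (r + 1))) * g_power r"
proof -
  have "(\<integral>\<^sup>+t\<in>{0<..<1}. ennreal ((\<bar>v\<bar> * g t) powr r) \<partial>lborel) = ennreal (\<bar>v\<bar> powr r) * g_power r" for v
    unfolding g_power_def
    by (subst nn_integral_cmult[symmetric])
      (auto intro!: nn_integral_cong simp: indicator_def powr_mult g_nonneg ennreal_mult')
  then have "(\<integral>\<^sup>+v\<in>{-1/2<..<1/2}. (\<integral>\<^sup>+t\<in>{0<..<1}. ennreal ((\<bar>v\<bar> * g t) powr r) \<partial>lborel) \<partial>lborel)
     = (\<integral>\<^sup>+v. g_power r * (ennreal (\<bar>v\<bar> powr r) * indicator {-1/2<..<1/2} v) \<partial>lborel)"
    by (simp add: mult_ac)
  also have "\<dots> = g_power r * (\<integral>\<^sup>+v\<in>{-1/2<..<1/2}. ennreal (\<bar>v\<bar> powr r) \<partial>lborel)"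
    by (rule nn_integral_cmult) measurable
  finally show ?thesis
    unfolding nn_integral_abs_powr_symmetric[OF r] by (simp only: mult.commute)
qed

text \<open>The increment runs over rescaled length 2v, so half of it tends to |v| * g t. Fatou's
  lemma in \<open>ennreal\<close> covers an infinite \<open>g_power r\<close> as well.\<close>

lemma sym_mean_power_liminf:
  assumes r: "r \<ge> 1"
  shows "ennreal (1 / (2 powr r * (r + 1))) * g_power r \<le> liminf (sym_mean_power r)"
  unfolding integral_scaled_g_power[OF r, symmetric] sym_mean_power_def[abs_def]
proof (rule nested_Fatou)
  fix v :: real assume "v \<in> {-1/2<..<1/2}"
  then have v: "\<bar>v\<bar> \<le> 1/2" "\<bar>- v\<bar> \<le> 1/2" by auto
  show "AE t in lborel. t \<in> {0<..<1} \<longrightarrow> (\<lambda>n. ennreal ((real n * \<bar>Q (cell_mid n t + v / real n)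
      - Q (cell_mid n t - v / real n)\<bar> / 2) powr r)) \<longlonglongrightarrow> ennreal ((\<bar>v\<bar> * g t) powr r)"
    using AE_DERIV_Q
  proof (eventually_elim, intro impI)
    fix t :: real assume D: "t \<in> {0<..<1} \<longrightarrow> (Q has_real_derivative g t) (at t)" and t: "t \<in> {0<..<1}"
    then have g: "g t \<ge> 0" using g_nonneg by simp
    have "(\<lambda>n. \<bar>real n * (Q (cell_mid n t + v / real n) - Q (cell_mid n t + (- v) / real n))\<bar> / 2)
         \<longlonglongrightarrow> \<bar>(v - - v) * g t\<bar> / 2"
      using D t by (intro tendsto_intros cell_difference_quotient_tendsto v) auto
    then have "(\<lambda>n. real n * \<bar>Q (cell_mid n t + v / real n) - Q (cell_mid n t - v / real n)\<bar> / 2)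
         \<longlonglongrightarrow> \<bar>v\<bar> * g t"
      using g by (simp add: abs_mult)
    then show "(\<lambda>n. ennreal ((real n * \<bar>Q (cell_mid n t + v / real n)
      - Q (cell_mid n t - v / real n)\<bar> / 2) powr r)) \<longlonglongrightarrow> ennreal ((\<bar>v\<bar> * g t) powr r)"
      using r by (intro tendsto_ennrealI tendsto_powr') auto
  qed
qed measurable


section \<open>The upper bound from midpoint atoms\<close>

text \<open>The integrand is constant on each cell, the cell length 1/n cancels the factor n, and
  the increments telescope. Hence the cell means have the same total for every n.\<close>

lemma nn_integral_cell_increments:
  fixes G :: "real \<Rightarrow> real"
  assumes [measurable]: "G \<in> borel_measurable borel" and n: "n > 0"
    and mono: "\<And>i. i < n \<Longrightarrow> G (real i / real n) \<le> G (real (Suc i) / real n)"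
  shows "(\<integral>\<^sup>+t\<in>{0<..<1}. ennreal (real n * (G (cell_mid n t + (1/2) / real n)
     - G (cell_mid n t + (- (1/2)) / real n))) \<partial>lborel) = ennreal (G 1 - G 0)"
proof -
  let ?E = "\<lambda>t. ennreal (real n * (G (cell_mid n t + (1/2) / real n) - G (cell_mid n t + (- (1/2)) / real n)))"
  have "(\<integral>\<^sup>+v\<in>{-1/2<..<1/2}. ?E ((real i + 1/2 + v) / real n) \<partial>lborel)
     = ennreal (real n * (G (real (Suc i) / real n) - G (real i / real n)))" for i
  proof -
    have "(\<integral>\<^sup>+v\<in>{-1/2<..<1/2}. ?E ((real i + 1/2 + v) / real n) \<partial>lborel)
      = (\<integral>\<^sup>+v\<in>{-1/2<..<1/2::real}. ennreal (real n * (G (real (Suc i) / real n) - G (real i / real n))) \<partial>lborel)"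
    proof (rule nn_integral_cong)
      fix v :: real
      show "?E ((real i + 1/2 + v) / real n) * indicator {-1/2<..<1/2} v
        = ennreal (real n * (G (real (Suc i) / real n) - G (real i / real n))) * indicator {-1/2<..<1/2} v"
      proof (cases "v \<in> {-1/2<..<1/2}")
        case True
        then have "\<bar>v\<bar> < 1/2" by auto
        from floor_cell_eq[OF n this, of i]
        have "cell_mid n ((real i + 1/2 + v) / real n) = (real i + 1/2) / real n"
          by (simp add: cell_mid_def)
        then have "cell_mid n ((real i + 1/2 + v) / real n) + (1/2) / real n = real (Suc i) / real n"
          "cell_mid n ((real i + 1/2 + v) / real n) + (- (1/2)) / real n = real i / real n"
          using n by (simp_all add: field_simps)
        then show ?thesis by (simp only:)
      qed simp
    qed
    then show ?thesis by (simp add: nn_integral_cmult_indicator)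
  qed
  then have "(\<integral>\<^sup>+t\<in>{0<..<1}. ?E t \<partial>lborel)
    = (\<Sum>i<n. ennreal (1 / real n) * ennreal (real n * (G (real (Suc i) / real n) - G (real i / real n))))"
    by (subst nn_integral_cells[OF _ n]) simp_all
  also have "\<dots> = (\<Sum>i<n. ennreal (G (real (Suc i) / real n) - G (real i / real n)))"
    using n by (intro sum.cong refl) (simp add: ennreal_mult'[symmetric])
  also have "\<dots> = ennreal (\<Sum>i<n. G (real (Suc i) / real n) - G (real i / real n))"
    by (rule sum_ennreal) (use mono in simp)
  also have "\<dots> = ennreal (G 1 - G 0)"
    using sum_lessThan_telescope[of "\<lambda>i. G (real i / real n)" n] n by simp
  finally show ?thesis .
qed

text \<open>The integrand f lies below the cell mean E, which converges almost everywhere and has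
  constant integral. Fatou's lemma for E - f therefore acts as dominated convergence with a moving
  majorant.\<close>

lemma mean_power_midpoints_tendsto:
  assumes r: "r \<ge> 1" and fin: "g_power r < \<infinity>"
  defines "c \<equiv> 1 / (2 powr r * (r + 1))"
  shows "(\<lambda>n. enn2real (mean_power r n (\<lambda>i. Q ((2 * real i + 1) / (2 * real n))))) \<longlonglongrightarrow> c * enn2real (g_power r)"
proof -
  let ?V = "{-1/2<..<1/2::real}" and ?U = "{0<..<1::real}"
  let ?P = "\<lambda>n. mean_power r n (\<lambda>i. Q ((2 * real i + 1) / (2 * real n)))"
  \<comment> \<open>Extension by 0 gives a primitive G on the whole line, which may be evaluated at
    0 and 1, the ends of the outermost cells.\<close>
  define \<gamma> where "\<gamma> t = g t powr r * indicator ?U t" for t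
  define I where "I = enn2real (g_power r)"
  have I: "g_power r = ennreal I" "I \<ge> 0" using fin by (auto simp: I_def less_top)
  have \<gamma>m [measurable]: "\<gamma> \<in> borel_measurable borel" unfolding \<gamma>_def by measurable
  have \<gamma>0: "\<gamma> t \<ge> 0" for t by (simp add: \<gamma>_def)
  have \<gamma>I: "(\<integral>\<^sup>+t. ennreal (\<gamma> t) \<partial>lborel) = ennreal I"
    unfolding I(1)[symmetric] g_power_def \<gamma>_def by (intro nn_integral_cong) (auto simp: indicator_def)
  have \<gamma>hb: "has_bochner_integral lborel \<gamma> I"
    by (rule has_bochner_integral_nn_integral) (use I \<gamma>I \<gamma>0 in auto)
  then have \<gamma>int: "integrable lborel \<gamma>" and \<gamma>LI: "(LINT t|lborel. \<gamma> t) = I"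
    by (auto simp: has_bochner_integral_iff)
  have \<gamma>set: "set_integrable lborel A \<gamma>" if "A \<in> sets borel" for A
    using set_integrable_subset[of lborel UNIV \<gamma> A] \<gamma>int that by (simp add: set_integrable_def)
  define G where "G t = (LINT s:{..t}|lborel. \<gamma> s)" for t
  have G: "G b - G a = (LINT s:{a..b}|lborel. \<gamma> s)" if "a \<le> b" for a b
  proof -
    have "{..b} = {..a} \<union> {a<..b}" using that by auto
    then have "G b = G a + (LINT s:{a<..b}|lborel. \<gamma> s)"
      unfolding G_def by (simp only:) (rule set_integral_Un, auto intro: \<gamma>set)
    also have "(LINT s:{a<..b}|lborel. \<gamma> s) = (LINT s:{a..b}|lborel. \<gamma> s)"
      unfolding set_lebesgue_integral_def
    proof (rule integral_cong_AE)
      show "AE s in lborel. indicator {a<..b} s *\<^sub>R \<gamma> s = indicator {a..b} s *\<^sub>R \<gamma> s"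
        using AE_lborel_singleton[of a] by eventually_elim (auto simp: indicator_def)
    qed measurable
    finally show ?thesis by simp
  qed
  have Gmono: "mono G"
  proof (rule monoI)
    fix a b :: real assume "a \<le> b"
    then have "0 \<le> G b - G a"
      unfolding G[OF \<open>a \<le> b\<close>] set_lebesgue_integral_def
      by (intro integral_nonneg_AE) (auto simp: \<gamma>0)
    then show "G a \<le> G b" by simp
  qed
  then have [measurable]: "G \<in> borel_measurable borel" by (rule borel_measurable_mono)
  have G01: "G 1 - G 0 = I"
    unfolding \<gamma>LI[symmetric] using G[of 0 1]
    by (simp add: set_lebesgue_integral_def) (intro Bochner_Integration.integral_cong, auto simp: \<gamma>_def indicator_def)
  have DG: "AE t in lborel. (G has_real_derivative \<gamma> t) (at t)"
    using AE_DERIV_indefinite_integral[OF \<gamma>int open_UNIV, of G] G by simp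

  define E where "E n t = real n * (G (cell_mid n t + (1/2) / real n) - G (cell_mid n t + (- (1/2)) / real n))" for n t
  define f where "f n v t = (real n * \<bar>Q (cell_mid n t) - Q (cell_mid n t + v / real n)\<bar>) powr r" for n v t
  have [measurable]: "E n \<in> borel_measurable borel" for n unfolding E_def by measurable
  have [measurable]: "case_prod (f n) \<in> borel_measurable (borel \<Otimes>\<^sub>M borel)" for n unfolding f_def by measurable
  have f0: "f n v t \<ge> 0" for n v t by (simp add: f_def)
  have fE: "f n v t \<le> E n t" if n: "n > 0" and t: "t \<in> ?U" and v: "v \<in> ?V" for n v t
  proof -
    \<comment> \<open>a and b are the ends of the cell and may be 0 or 1; c and d below are the two
      arguments of Q in increasing order, strictly inside.\<close>
    define a b where "a = cell_mid n t + (- (1/2)) / real n" and "b = cell_mid n t + (1/2) / real n"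
    have "\<bar>v\<bar> < 1/2" using v by auto
    define c d where "c = min (cell_mid n t) (cell_mid n t + v / real n)"
      and "d = max (cell_mid n t) (cell_mid n t + v / real n)"
    have cd: "0 < c" "d < 1"
      using cell_points_in_unit[OF n t \<open>\<bar>v\<bar> < 1/2\<close>] cell_points_in_unit[OF n t, of 0]
      by (auto simp: c_def d_def)
    have "\<bar>v / real n\<bar> < (1/2) / real n"
      using divide_strict_right_mono[OF \<open>\<bar>v\<bar> < 1/2\<close>, of "real n"] n by (simp only: abs_divide abs_of_nat of_nat_0_less_iff)
    moreover have "(- (1/2)) / real n = - ((1/2) / real n)" "0 < (1/2) / real n" using n by simp_all
    ultimately have abcd: "a < c" "d < b" "c \<le> d"
      unfolding a_def b_def c_def d_def abs_less_iff min_def max_def by (auto simp del: divide_divide_eq_left)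
    have ba: "b - a = 1 / real n" by (simp add: a_def b_def)
    have Qcd: "Q c \<le> Q d" using cd abcd by (intro Q_mono) auto
    \<comment> \<open>y is the mean of \<open>g s * indicator {c<..d} s\<close> over the whole cell,
      of length 1/n; with this choice the linear term of the tangent integrates to 0.\<close>
    define y where "y = real n * (Q d - Q c)"
    have y: "y \<ge> 0" using Qcd by (simp add: y_def)
    have fy: "f n v t = y powr r"
      using Qcd unfolding f_def y_def c_def d_def min_def max_def
      by (auto simp: abs_if split: if_splits)
    have hb: "has_bochner_integral lborel (\<lambda>s. g s * indicator {c<..d} s) (Q d - Q c)"
    proof (cases "c = d")
      case False
      with cd abcd show ?thesis by (intro g_integral_increment) auto
    qed (simp add: has_bochner_integral_zero)
    \<comment> \<open>Jensen: integrate the tangent of the r-th power at the mean slope y; outside \<open>{c<..d}\<close> the value 0 replaces g.\<close>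
    let ?l = "\<lambda>s. indicator {a..b} s * y powr r + r * y powr (r - 1) * (g s * indicator {c<..d} s - indicator {a..b} s * y)"
    have ind: "has_bochner_integral lborel (indicator {a..b} :: real \<Rightarrow> real) (1 / real n)"
      using has_bochner_integral_real_indicator[of "{a..b}" lborel] abcd ba by simp
    have "has_bochner_integral lborel ?l (1 / real n * y powr r + r * y powr (r - 1) * ((Q d - Q c) - 1 / real n * y))"
      by (intro has_bochner_integral_add has_bochner_integral_diff has_bochner_integral_mult_right
        has_bochner_integral_mult_left hb ind)
    moreover have "(Q d - Q c) - 1 / real n * y = 0" using n by (simp add: y_def)
    ultimately have l: "integrable lborel ?l" "(LINT s|lborel. ?l s) = y powr r / real n"
      by (auto simp: has_bochner_integral_iff)
    have "(LINT s|lborel. ?l s) \<le> (LINT s|lborel. indicator {a..b} s *\<^sub>R \<gamma> s)"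
    proof (rule integral_mono[OF l(1)])
      show "integrable lborel (\<lambda>s. indicator {a..b} s *\<^sub>R \<gamma> s)"
        using \<gamma>set[of "{a..b}"] by (simp add: set_integrable_def)
      fix s
      show "?l s \<le> indicator {a..b} s *\<^sub>R \<gamma> s"
      proof (cases "s \<in> {c<..d}")
        case True
        then have s: "s \<in> {a..b}" "s \<in> ?U" "g s \<ge> 0" using abcd cd g_nonneg by auto
        from powr_above_tangent[OF r s(3) y] s True show ?thesis by (simp add: \<gamma>_def)
      next
        case False
        with powr_above_tangent[OF r order_refl y] \<gamma>0[of s] r show ?thesis
          by (cases "s \<in> {a..b}") auto
      qed
    qed
    also have "\<dots> = G b - G a"
      using G[of a b] abcd by (simp add: set_lebesgue_integral_def)
    finally have "y powr r \<le> real n * (G b - G a)"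
      using n unfolding l(2) by (simp add: divide_le_eq mult.commute)
    then show ?thesis unfolding fy E_def a_def b_def .
  qed
  have E0: "E n t \<ge> 0" for n t
    unfolding E_def using monoD[OF Gmono] by (auto intro!: mult_nonneg_nonneg divide_right_mono)
  have EI: "(\<integral>\<^sup>+t\<in>?U. ennreal (E n t) \<partial>lborel) = ennreal I" if "n > 0" for n
    unfolding E_def G01[symmetric]
    by (rule nn_integral_cell_increments[OF _ that])
      (measurable, rule monoD[OF Gmono], simp add: divide_right_mono)
  have V1: "(\<integral>\<^sup>+v\<in>?V. k \<partial>lborel) = k" for k
    by (simp add: nn_integral_cmult_indicator)
  \<comment> \<open>The gap between E and f; together with the scaled error it always amounts to
    I.\<close>
  define A where "A n = (\<integral>\<^sup>+v\<in>?V. (\<integral>\<^sup>+t\<in>?U. ennreal (E n t - f n v t) \<partial>lborel) \<partial>lborel)" for n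
  have P: "?P n = (\<integral>\<^sup>+v\<in>?V. (\<integral>\<^sup>+t\<in>?U. ennreal (f n v t) \<partial>lborel) \<partial>lborel)" if "n > 0" for n
  proof -
    have mid: "(2 * real (nat \<lfloor>real n * t\<rfloor>) + 1) / (2 * real n) = cell_mid n t" if "t \<in> ?U" for t
      using that \<open>n > 0\<close> by (simp add: cell_mid_def field_simps)
    have "ennreal ((real n * \<bar>Q ((2 * real (nat \<lfloor>real n * t\<rfloor>) + 1) / (2 * real n)) - Q (cell_mid n t + v / real n)\<bar>) powr r)
        * indicator ?U t = ennreal (f n v t) * indicator ?U t" for v t
      by (cases "t \<in> ?U") (simp_all only: mid f_def indicator_simps mult_zero_right simp_thms)
    then show ?thesis
      unfolding mean_power_cells[OF that] by (simp only:)
  qed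
  have AP: "A n + ?P n = ennreal I" if n: "n > 0" for n
    using nested_nn_integral_diff[of "E n" "f n" ?U ?V] f0 fE[OF n]
    unfolding A_def P[OF n] EI[OF n] V1 by simp
  have lim: "(\<integral>\<^sup>+v\<in>?V. (\<integral>\<^sup>+t\<in>?U. ennreal (g t powr r - (\<bar>v\<bar> * g t) powr r) \<partial>lborel) \<partial>lborel) \<le> liminf A"
    unfolding A_def[abs_def]
  proof (rule nested_Fatou)
    fix v :: real assume "v \<in> ?V"
    then have v: "\<bar>v\<bar> \<le> 1/2" by auto
    show "AE t in lborel. t \<in> ?U \<longrightarrow> (\<lambda>n. ennreal (E n t - f n v t)) \<longlonglongrightarrow> ennreal (g t powr r - (\<bar>v\<bar> * g t) powr r)"
      using AE_DERIV_Q DG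
    proof (eventually_elim, intro impI)
      fix t :: real assume D: "t \<in> ?U \<longrightarrow> (Q has_real_derivative g t) (at t)" and t: "t \<in> ?U"
        and DG: "(G has_real_derivative \<gamma> t) (at t)"
      then have g: "g t \<ge> 0" using g_nonneg by simp
      have "E n t = real n * (G (cell_mid n t + (1/2) / real n) - G (cell_mid n t + (- (1/2)) / real n))" for n
        by (simp add: E_def)
      \<comment> \<open>Over the full cell \<beta> - \<alpha> is 1, so the means tend to
        \<open>g t powr r\<close>; for f, from v to the midpoint, it is -v.\<close>
      then have "(\<lambda>n. E n t) \<longlonglongrightarrow> (1/2 - - (1/2)) * \<gamma> t"
        using cell_difference_quotient_tendsto[OF DG, of "- (1/2)" "1/2"] by simp
      then have E: "(\<lambda>n. E n t) \<longlonglongrightarrow> g t powr r" using t by (simp add: \<gamma>_def)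
      have "(\<lambda>n. \<bar>real n * (Q (cell_mid n t + 0 / real n) - Q (cell_mid n t + v / real n))\<bar>)
         \<longlonglongrightarrow> \<bar>(0 - v) * g t\<bar>"
        using D t by (intro tendsto_intros cell_difference_quotient_tendsto v) auto
      then have "(\<lambda>n. real n * \<bar>Q (cell_mid n t) - Q (cell_mid n t + v / real n)\<bar>) \<longlonglongrightarrow> \<bar>v\<bar> * g t"
        using g by (simp add: abs_mult)
      then have "(\<lambda>n. f n v t) \<longlonglongrightarrow> (\<bar>v\<bar> * g t) powr r"
        unfolding f_def using r by (intro tendsto_powr') auto
      with E show "(\<lambda>n. ennreal (E n t - f n v t)) \<longlonglongrightarrow> ennreal (g t powr r - (\<bar>v\<bar> * g t) powr r)"
        by (intro tendsto_ennrealI tendsto_diff)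
    qed
  qed measurable
  have c0: "c \<ge> 0" using r by (simp add: c_def)
  have scaled_le: "(\<bar>v\<bar> * g t) powr r \<le> g t powr r" if "v \<in> ?V" "t \<in> ?U" for v t
    using that r g_nonneg[of t] by (intro powr_mono2) (auto intro!: mult_left_le_one_le)
  \<comment> \<open>The same splitting for the limit functions: the limiting gap and c * I again add
    up to I.\<close>
  have K: "(\<integral>\<^sup>+v\<in>?V. (\<integral>\<^sup>+t\<in>?U. ennreal (g t powr r - (\<bar>v\<bar> * g t) powr r) \<partial>lborel) \<partial>lborel)
      + ennreal (c * I) = ennreal I" (is "?A + _ = _")
  proof -
    have cI: "ennreal (c * I) = (\<integral>\<^sup>+v\<in>?V. (\<integral>\<^sup>+t\<in>?U. ennreal ((\<bar>v\<bar> * g t) powr r) \<partial>lborel) \<partial>lborel)"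
      unfolding integral_scaled_g_power[OF r] I(1) c_def[symmetric] using c0 I(2) by (rule ennreal_mult)
    show ?thesis
      using nested_nn_integral_diff[of "\<lambda>t. g t powr r" "\<lambda>v t. (\<bar>v\<bar> * g t) powr r" ?U ?V] scaled_le
      unfolding cI g_power_def[symmetric] I(1) V1 by simp
  qed
  have fin_A: "A n < \<infinity>" "?P n < \<infinity>" if "n > 0" for n
    using AP[OF that] by (auto simp: less_top[symmetric] top_unique)
  have fin_K: "?A < \<infinity>" using K by (auto simp: less_top[symmetric] top_unique)
  show "(\<lambda>n. enn2real (?P n)) \<longlonglongrightarrow> c * enn2real (g_power r)"
    unfolding I_def[symmetric]
  proof (rule tendsto_of_complementary_liminf)
    have ev: "eventually (\<lambda>n. ennreal (enn2real (A n)) = A n) sequentially"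
      "eventually (\<lambda>n. ennreal (enn2real (?P n)) = ?P n) sequentially"
      using eventually_gt_at_top[of 0] by (eventually_elim, use fin_A in simp)+
    have "?A \<le> liminf (\<lambda>n. ennreal (enn2real (A n)))"
      using lim Liminf_eq[OF ev(1)] by simp
    then show "ennreal (enn2real ?A) \<le> liminf (\<lambda>n. ennreal (enn2real (A n)))"
      using fin_K by simp
    \<comment> \<open>The lower bound holds for arbitrary atoms, in particular for the midpoint
      ones.\<close>
    have "ennreal (c * I) \<le> liminf (sym_mean_power r)"
      using sym_mean_power_liminf[OF r] c0 I(2) unfolding I(1) c_def[symmetric] by (simp only: ennreal_mult)
    also have "\<dots> \<le> liminf ?P"
      by (rule Liminf_mono, rule eventually_mono[OF eventually_gt_at_top[of 0]])
        (rule sym_mean_power_le_mean_power[OF r])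
    also have "\<dots> = liminf (\<lambda>n. ennreal (enn2real (?P n)))"
      using Liminf_eq[OF ev(2)] by simp
    finally show "ennreal (c * I) \<le> liminf (\<lambda>n. ennreal (enn2real (?P n)))" .
    have K': "enn2real ?A + c * I = I"
      using arg_cong[OF K, of enn2real] fin_K c0 I(2) by (subst (asm) enn2real_plus) (auto simp: less_top)
    show "eventually (\<lambda>n. enn2real (A n) + enn2real (?P n) = enn2real ?A + c * I) sequentially"
      using eventually_gt_at_top[of 0]
    proof eventually_elim
      case (elim n)
      from arg_cong[OF AP[OF this], of enn2real] fin_A[OF this] I(2) show ?case
        unfolding K' by (subst (asm) enn2real_plus) (auto simp: less_top)
    qed
  qed auto
qed

end

section \<open>Quantile functions of probability measures\<close>

lemma is_borel_prob_real_distribution: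
  "is_borel_prob \<mu> \<Longrightarrow> real_distribution \<mu>"
  unfolding is_borel_prob_def real_distribution_def real_distribution_axioms_def by simp

lemma cdf_of_eq_cdf: "cdf_of \<mu> = cdf \<mu>"
  by (simp add: fun_eq_iff cdf_of_def cdf_def2)

context
  fixes \<mu> :: "real measure"
  assumes prob: "is_borel_prob \<mu>"
begin

interpretation real_distribution \<mu>
  by (rule is_borel_prob_real_distribution[OF prob])

text \<open>The real \<open>Sup\<close> is meaningful only for nonempty bounded sets; the limits 0
  and 1 of the distribution function provide both.\<close>

lemma quantile_set_nonempty_bdd:
  assumes "0 < t" "t < 1"
  shows "{x. cdf_of \<mu> x \<le> t} \<noteq> {}" "bdd_above {x. cdf_of \<mu> x \<le> t}"
proof -
  have "eventually (\<lambda>x. cdf \<mu> x < t) at_bot"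
    by (rule order_tendstoD(2)[OF cdf_lim_at_bot assms(1)])
  then show "{x. cdf_of \<mu> x \<le> t} \<noteq> {}"
    by (auto simp: cdf_of_eq_cdf eventually_at_bot_linorder intro: less_imp_le)
  have "eventually (\<lambda>x. t < cdf \<mu> x) at_top"
    by (rule order_tendstoD(1)[OF cdf_lim_at_top_prob assms(2)])
  then obtain y where y: "t < cdf \<mu> y"
    by (auto simp: eventually_at_top_linorder)
  show "bdd_above {x. cdf_of \<mu> x \<le> t}"
  proof (rule bdd_aboveI)
    fix x assume "x \<in> {x. cdf_of \<mu> x \<le> t}"
    with y have "cdf \<mu> x < cdf \<mu> y" by (simp add: cdf_of_eq_cdf)
    then show "x \<le> y" using cdf_nondecreasing[of y x] by linarith
  qed
qed

lemma quantile_le: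
  assumes "0 < t" "t < cdf_of \<mu> y" shows "quantile \<mu> t \<le> y"
proof -
  have "t < 1" using assms(2) cdf_bounded_prob[of y] by (simp add: cdf_of_eq_cdf)
  note ne = quantile_set_nonempty_bdd[OF assms(1) this]
  show ?thesis unfolding quantile_def
  proof (rule cSup_least[OF ne(1)])
    fix x assume "x \<in> {x. cdf_of \<mu> x \<le> t}"
    with assms have "cdf \<mu> x < cdf \<mu> y" by (simp add: cdf_of_eq_cdf)
    then show "x \<le> y" using cdf_nondecreasing[of y x] by linarith
  qed
qed

text \<open>Right continuity keeps the distribution function below t slightly beyond y, which makes
  the inequality strict. Together with \<open>quantile_le\<close> this leaves only the level t =
  F(y) undecided.\<close>

lemma less_quantile:
  assumes "cdf_of \<mu> y < t" "t < 1" shows "y < quantile \<mu> t"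
proof -
  have "0 < t" using assms(1) cdf_nonneg[of y] by (simp add: cdf_of_eq_cdf)
  note ne = quantile_set_nonempty_bdd[OF this assms(2)]
  have "(cdf \<mu> \<longlongrightarrow> cdf \<mu> y) (at_right y)"
    using cdf_is_right_cont[of y] by (simp add: continuous_within)
  then have "eventually (\<lambda>x. cdf \<mu> x < t) (at_right y)"
    using assms by (intro order_tendstoD(2)) (auto simp: cdf_of_eq_cdf)
  then obtain b where b: "b > y" "\<And>x. y < x \<Longrightarrow> x < b \<Longrightarrow> cdf \<mu> x < t"
    by (auto simp: eventually_at_right_field)
  then have "(y + b) / 2 \<in> {x. cdf_of \<mu> x \<le> t}"
    by (auto simp: cdf_of_eq_cdf intro!: less_imp_le)
  from cSup_upper[OF this ne(2)] b(1) show ?thesis unfolding quantile_def by simp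
qed

lemma quantile_mono: "0 < t \<Longrightarrow> t \<le> u \<Longrightarrow> u < 1 \<Longrightarrow> quantile \<mu> t \<le> quantile \<mu> u"
  unfolding quantile_def
  by (rule cSup_subset_mono) (use quantile_set_nonempty_bdd[of t] quantile_set_nonempty_bdd[of u] in auto)

lemma quantile_measurable_unit:
  "quantile \<mu> \<in> borel_measurable (restrict_space borel {0<..<1})"
  by (rule borel_measurable_mono_on_fnc) (auto intro!: mono_onI intro: quantile_mono)

text \<open>Monotonicity, hence measurability, is available inside ]0,1[ only; the indicator yields
  a function measurable on the whole line.\<close>

lemma quantile_measurable_indicator:
  "(\<lambda>t. quantile \<mu> t * indicator {0<..<1} t) \<in> borel_measurable borel"
  using quantile_measurable_unit
  by (subst (asm) borel_measurable_restrict_space_iff) (auto simp: mult.commute)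

text \<open>The set of t with quantile at most y lies between ]0, F(y)[ and ]0, F(y)], up to the
  restriction to ]0,1[, and so has measure F(y).\<close>

lemma distr_quantile: "distr (restrict_space lborel {0<..<1}) borel (quantile \<mu>) = \<mu>" (is "?D = _")
proof -
  let ?U = "restrict_space lborel {0<..<1::real}"
  have m [measurable]: "quantile \<mu> \<in> borel_measurable ?U"
    using quantile_measurable_unit by (simp cong: measurable_cong_sets add: sets_restrict_space)
  have "emeasure ?U (space ?U) = 1"
    by (simp add: emeasure_restrict_space space_restrict_space)
  then interpret U: prob_space ?U by (rule prob_spaceI)
  interpret D: real_distribution ?D by (rule U.real_distribution_distr) measurable
  show ?thesis
  proof (rule cdf_unique)
    show "cdf ?D = cdf \<mu>"
    proof
      fix y
      define E where "E = quantile \<mu> -` {..y} \<inter> space ?U"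
      have E: "E \<in> sets ?U" unfolding E_def by measurable
      then have E': "E \<in> sets lborel" "E \<subseteq> {0<..<1}"
        by (auto simp: sets_restrict_space_iff E_def space_restrict_space)
      have c: "0 \<le> cdf \<mu> y" "cdf \<mu> y \<le> 1" by (rule cdf_nonneg, rule cdf_bounded_prob)
      have "emeasure lborel {0<..<cdf \<mu> y} \<le> emeasure lborel E"
        using c by (intro emeasure_mono E')
          (auto simp: E_def space_restrict_space cdf_of_eq_cdf intro!: quantile_le)
      moreover have "emeasure lborel E \<le> emeasure lborel {0<..cdf \<mu> y}"
      proof (intro emeasure_mono subsetI)
        fix t assume "t \<in> E"
        then have "0 < t" "t < 1" "quantile \<mu> t \<le> y" by (auto simp: E_def space_restrict_space)
        with less_quantile[of y t] show "t \<in> {0<..cdf \<mu> y}"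
          by (auto simp: cdf_of_eq_cdf not_less[symmetric])
      qed simp
      ultimately have "emeasure lborel E = cdf \<mu> y"
        using c by (intro antisym) simp_all
      then have "emeasure ?D {..y} = cdf \<mu> y"
        using E' E_def by (subst emeasure_distr) (simp_all add: space_restrict_space emeasure_restrict_space)
      then show "cdf ?D y = cdf \<mu> y"
        using c by (simp add: cdf_def2 measure_def)
    qed
  qed unfold_locales
qed

lemma nn_integral_quantile:
  assumes [measurable]: "h \<in> borel_measurable borel"
  shows "(\<integral>\<^sup>+x. h x \<partial>\<mu>) = (\<integral>\<^sup>+t\<in>{0<..<1}. h (quantile \<mu> t) \<partial>lborel)"
proof -
  have m [measurable]: "quantile \<mu> \<in> borel_measurable (restrict_space lborel {0<..<1::real})"
    using quantile_measurable_unit by (simp cong: measurable_cong_sets add: sets_restrict_space)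
  show ?thesis
    by (subst distr_quantile[symmetric], subst nn_integral_distr)
      (simp_all add: nn_integral_restrict_space)
qed

lemma eq_return_of_quantile_const:
  assumes "\<And>t. 0 < t \<Longrightarrow> t < 1 \<Longrightarrow> quantile \<mu> t = a"
  shows "\<mu> = return borel a"
proof -
  let ?U = "restrict_space lborel {0<..<1::real}"
  have "emeasure ?U (space ?U) = 1"
    by (simp add: emeasure_restrict_space space_restrict_space)
  then interpret U: prob_space ?U by (rule prob_spaceI)
  have "\<mu> = distr ?U borel (quantile \<mu>)" by (simp add: distr_quantile)
  also have "\<dots> = distr ?U borel (\<lambda>_. a)"
    by (rule distr_cong) (auto simp: space_restrict_space assms)
  finally show ?thesis by simp
qed

end

section \<open>From the Kantorovich distance to the scaled error\<close>

text \<open>With k the floor of n * t, the distribution function at y is at most t iff at most k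
  atoms are <= y, which for sorted atoms means y < x k. Being the upper quantile, it agrees with the
  floor even at cell boundaries.\<close>

lemma quantile_unif_discrete:
  assumes x: "x \<in> Xi n" and n: "n > 0" and t: "0 < t" "t < 1"
  shows "quantile (unif_discrete n x) t = x (nat \<lfloor>real n * t\<rfloor>)"
proof -
  define k where "k = nat \<lfloor>real n * t\<rfloor>"
  have k: "real k \<le> real n * t" "real n * t < real k + 1"
    using t n unfolding k_def by auto
  have "real n * t < real n" using t n by simp
  with k have kn: "k < n" by linarith
  have cdf: "cdf_of (unif_discrete n x) y = real (card {i. i < n \<and> x i \<le> y}) / real n" for y
  proof -
    have "x -` {..y} \<inter> {..<n} = {i. i < n \<and> x i \<le> y}" "{i. i < n \<and> x i \<le> y} \<subseteq> {..<n}"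
      by auto
    then show ?thesis
      unfolding cdf_of_def unif_discrete_def
      by (subst measure_distr)
        (simp_all add: measure_uniform_count_measure space_uniform_count_measure)
  qed
  have "{y. cdf_of (unif_discrete n x) y \<le> t} = {..<x k}"
  proof (intro set_eqI iffI)
    fix y assume "y \<in> {y. cdf_of (unif_discrete n x) y \<le> t}"
    then have "real (card {i. i < n \<and> x i \<le> y}) \<le> real n * t"
      using n by (simp add: cdf field_simps)
    with k have c: "card {i. i < n \<and> x i \<le> y} \<le> k" by linarith
    show "y \<in> {..<x k}"
    proof (rule ccontr)
      assume "y \<notin> {..<x k}"
      then have "x i \<le> y" if "i \<le> k" for i
        using x kn that unfolding Xi_def by force
      with kn have "{..k} \<subseteq> {i. i < n \<and> x i \<le> y}" by auto
      from card_mono[OF _ this] c show False by simp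
    qed
  next
    fix y assume y: "y \<in> {..<x k}"
    have "{i. i < n \<and> x i \<le> y} \<subseteq> {..<k}"
    proof
      fix i assume i: "i \<in> {i. i < n \<and> x i \<le> y}"
      show "i \<in> {..<k}"
      proof (rule ccontr)
        assume "i \<notin> {..<k}"
        then have "x k \<le> x i" using x i unfolding Xi_def by simp
        with i y show False by simp
      qed
    qed
    from card_mono[OF _ this] have "real (card {i. i < n \<and> x i \<le> y}) \<le> real k" by simp
    with k have "real (card {i. i < n \<and> x i \<le> y}) \<le> real n * t" by linarith
    then show "y \<in> {y. cdf_of (unif_discrete n x) y \<le> t}"
      using n by (simp add: cdf field_simps)
  qed
  then show ?thesis unfolding quantile_def k_def[symmetric] by simp
qed

text \<open>The moment condition enters here. Finiteness is vital because \<open>enn2real\<close>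
  sends infinity to 0 and would break monotonicity.\<close>

lemma (in unit_interval_density) mean_power_finite:
  assumes r: "r \<ge> 1" and n: "n > 0"
    and J: "(\<integral>\<^sup>+t\<in>{0<..<1}. ennreal (\<bar>Q t\<bar> powr r) \<partial>lborel) < \<infinity>"
  shows "mean_power r n x < \<infinity>"
proof -
  let ?U = "{0<..<1::real}"
  let ?J = "\<integral>\<^sup>+t\<in>?U. ennreal (\<bar>Q t\<bar> powr r) \<partial>lborel"
  define M where "M = (2 * real n * (\<Sum>i<n. \<bar>x i\<bar>)) powr r"
  define N where "N = (2 * real n) powr r"
  have "mean_power r n x \<le> (\<integral>\<^sup>+t. ennreal M * indicator ?U t + ennreal N * (ennreal (\<bar>Q t\<bar> powr r) * indicator ?U t) \<partial>lborel)"
    unfolding mean_power_def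
  proof (rule nn_integral_mono)
    fix t :: real
    show "ennreal ((real n * \<bar>x (nat \<lfloor>real n * t\<rfloor>) - Q t\<bar>) powr r) * indicator ?U t
      \<le> ennreal M * indicator ?U t + ennreal N * (ennreal (\<bar>Q t\<bar> powr r) * indicator ?U t)"
    proof (cases "t \<in> ?U")
      case True
      then have "nat \<lfloor>real n * t\<rfloor> < n" using n by (simp add: nat_less_iff floor_less_iff)
      then have "\<bar>x (nat \<lfloor>real n * t\<rfloor>)\<bar> \<le> (\<Sum>i<n. \<bar>x i\<bar>)"
        by (intro member_le_sum) auto
      then have x: "2 * real n * \<bar>x (nat \<lfloor>real n * t\<rfloor>)\<bar> \<le> 2 * real n * (\<Sum>i<n. \<bar>x i\<bar>)"
        by (intro mult_left_mono) auto
      \<comment> \<open>The doubled terms have the sum bound as their midpoint, so midpoint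
        convexity separates x from Q.\<close>
      let ?a = "2 * real n * \<bar>x (nat \<lfloor>real n * t\<rfloor>)\<bar>" and ?b = "2 * real n * \<bar>Q t\<bar>"
      have "real n * \<bar>x (nat \<lfloor>real n * t\<rfloor>) - Q t\<bar> \<le> real n * (\<bar>x (nat \<lfloor>real n * t\<rfloor>)\<bar> + \<bar>Q t\<bar>)"
        by (intro mult_left_mono) auto
      then have "real n * \<bar>x (nat \<lfloor>real n * t\<rfloor>) - Q t\<bar> \<le> (?a + ?b) / 2"
        by (simp add: distrib_left)
      then have "(real n * \<bar>x (nat \<lfloor>real n * t\<rfloor>) - Q t\<bar>) powr r \<le> ((?a + ?b) / 2) powr r"
        using r by (intro powr_mono2) auto
      also have "\<dots> \<le> 2 * ((?a + ?b) / 2) powr r" by simp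
      also have "\<dots> \<le> ?a powr r + ?b powr r" by (rule powr_midpoint_le[OF r]) auto
      also have "\<dots> \<le> M + N * \<bar>Q t\<bar> powr r"
        unfolding M_def N_def using r x by (intro add_mono powr_mono2) (auto simp: powr_mult)
      finally have "ennreal ((real n * \<bar>x (nat \<lfloor>real n * t\<rfloor>) - Q t\<bar>) powr r) \<le> ennreal (M + N * \<bar>Q t\<bar> powr r)"
        by (rule ennreal_leI)
      then show ?thesis using True by (simp add: M_def N_def ennreal_mult')
    qed simp
  qed
  also have "\<dots> = ennreal M + ennreal N * ?J"
    by (subst nn_integral_add) (simp_all add: nn_integral_cmult nn_integral_cmult_indicator)
  also have "\<dots> < \<infinity>" using J by (simp add: ennreal_mult_less_top)
  finally show ?thesis .
qed

lemma kdist_nonneg: "kdist r \<mu> \<nu> \<ge> 0"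
  by (simp add: kdist_def)

text \<open>The Bochner integral of a nonnegative measurable function is \<open>enn2real\<close> of
  its nonnegative integral; the factor n enters the r-th power as \<open>n powr r\<close>.\<close>

lemma (in unit_interval_density) scaled_kdist_eq_mean_power:
  assumes r: "r \<ge> 1" and n: "n > 0" and x: "x \<in> Xi n"
    and Q: "\<And>t. 0 < t \<Longrightarrow> t < 1 \<Longrightarrow> Q t = quantile \<mu> t"
  shows "real n * kdist r (unif_discrete n x) \<mu> =
    enn2real (mean_power r n x) powr (1 / r)"
proof -
  let ?U = "{0<..<1::real}"
  let ?h = "\<lambda>t. \<bar>x (nat \<lfloor>real n * t\<rfloor>) - Q t\<bar> powr r"
  have [measurable]: "(\<lambda>t. x (nat \<lfloor>real n * t\<rfloor>)) \<in> borel_measurable borel"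
    by (rule measurable_compose_countable[where f="\<lambda>i t. x (nat i)"]) measurable
  define L where "L = (LINT t:?U|lborel. ?h t)"
  have L0: "L \<ge> 0" unfolding L_def set_lebesgue_integral_def by (intro integral_nonneg_AE) auto
  have "kdist r (unif_discrete n x) \<mu> = L powr (1 / r)"
    unfolding kdist_def L_def
    by (intro arg_cong2[where f="(powr)"] set_lebesgue_integral_cong refl)
      (auto simp: quantile_unif_discrete[OF x n] Q)
  moreover have "enn2real (mean_power r n x) = real n powr r * L"
  proof -
    have "mean_power r n x = ennreal (real n powr r) * (\<integral>\<^sup>+t\<in>?U. ennreal (?h t) \<partial>lborel)"
      unfolding mean_power_def
      by (subst nn_integral_cmult[symmetric])
        (auto intro!: nn_integral_cong simp: powr_mult ennreal_mult' mult.assoc)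
    moreover have "L = enn2real (\<integral>\<^sup>+t\<in>?U. ennreal (?h t) \<partial>lborel)"
      unfolding L_def set_lebesgue_integral_def
      by (subst integral_eq_nn_integral)
        (auto intro!: arg_cong[where f=enn2real] nn_integral_cong simp: indicator_def)
    ultimately show ?thesis by (simp add: enn2real_mult)
  qed
  ultimately show ?thesis using r n L0 by (simp add: powr_mult powr_powr)
qed

section \<open>The limit and asymptotic optimality of the midpoint quantiles\<close>

theorem theorem5p6:
  fixes r :: real and \<mu> :: "real measure" and g :: "real \<Rightarrow> real"
  assumes "r \<ge> 1" and "in_P r \<mu>" and "inverse_density \<mu> g"
  shows "((\<lambda>n. ereal (real n * best_unif_dist r \<mu> n)) \<longlongrightarrow>
            (let I = (\<integral>\<^sup>+ t\<in>{0<..<1}. ennreal (g t powr r) \<partial>lborel)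
             in if I = \<infinity> then \<infinity>
                else ereal (1 / (2 * (r + 1) powr (1 / r)) * enn2real I powr (1 / r)))) sequentially
       \<and> ((\<integral>\<^sup>+ t\<in>{0<..<1}. ennreal (g t powr r) \<partial>lborel) < \<infinity> \<longrightarrow>
          (\<forall>a. \<mu> \<noteq> return borel a) \<longrightarrow>
          (\<lambda>n. kdist r (unif_discrete n (\<lambda>i. quantile \<mu> ((2 * real i + 1) / (2 * real n)))) \<mu>
                / best_unif_dist r \<mu> n) \<longlonglongrightarrow> 1)"
proof -
  have r: "r \<ge> 1" by fact
  have prob: "is_borel_prob \<mu>" and mom: "(\<integral>\<^sup>+x. ennreal (\<bar>x\<bar> powr r) \<partial>\<mu>) < \<infinity>"
    using assms(2) by (auto simp: in_P_def)
  define Q where "Q t = quantile \<mu> t * indicator {0<..<1} t" for t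
  have Q: "Q t = quantile \<mu> t" if "0 < t" "t < 1" for t using that by (simp add: Q_def)
  interpret unit_interval_density Q g
  proof
    show "Q \<in> borel_measurable borel"
      unfolding Q_def[abs_def] by (rule quantile_measurable_indicator[OF prob])
    show "0 \<le> g t" if "0 < t" "t < 1" for t
      using assms(3) that by (auto simp: inverse_density_def)
    show "Q t \<le> Q u" if "0 < t" "t \<le> u" "u < 1" for t u
      using that quantile_mono[OF prob, of t u] by (simp add: Q)
    show "ennreal (Q u - Q t) = (\<integral>\<^sup>+s\<in>{t<..u}. ennreal (g s) \<partial>lborel)" if "0 < t" "t < u" "u < 1" for t u
      using that assms(3) by (simp add: Q inverse_density_def)
  qed (use assms(3) in \<open>simp add: inverse_density_def\<close>)
  let ?U = "{0<..<1::real}"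
  define c where "c = 1 / (2 powr r * (r + 1))"
  have c0: "c > 0" using r by (simp add: c_def)
  let ?x = "\<lambda>n i. quantile \<mu> ((2 * real i + 1) / (2 * real n))"
  let ?P = "\<lambda>n. mean_power r n (\<lambda>i. Q ((2 * real i + 1) / (2 * real n)))"

  have "(\<integral>\<^sup>+t\<in>?U. ennreal (\<bar>Q t\<bar> powr r) \<partial>lborel) = (\<integral>\<^sup>+x. ennreal (\<bar>x\<bar> powr r) \<partial>\<mu>)"
    by (subst nn_integral_quantile[OF prob])
      (auto intro!: nn_integral_cong simp: indicator_def Q)
  with mom have J: "(\<integral>\<^sup>+t\<in>?U. ennreal (\<bar>Q t\<bar> powr r) \<partial>lborel) < \<infinity>" by simp
  note fin = mean_power_finite[OF r _ J]
  have kd: "real n * kdist r (unif_discrete n x) \<mu> = enn2real (mean_power r n x) powr (1 / r)"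
    if "n > 0" "x \<in> Xi n" for n x
    by (rule scaled_kdist_eq_mean_power[OF r that]) (rule Q)
  have S_fin: "sym_mean_power r n < \<infinity>" if "n > 0" for n
    using sym_mean_power_le_mean_power[OF r that] fin[OF that] by (rule le_less_trans)

  have mid: "0 < (2 * real i + 1) / (2 * real n)" "(2 * real i + 1) / (2 * real n) < 1" if "i < n" for i n
    using that by (simp_all add: field_simps)
  have xXi: "?x n \<in> Xi n" for n
    unfolding Xi_def
  proof (intro CollectI allI impI)
    fix i j assume ij: "i \<le> j" "j < n"
    then show "?x n i \<le> ?x n j"
      using mid[of i n] mid[of j n] by (intro quantile_mono[OF prob] divide_right_mono) auto
  qed
  have xP: "real n * kdist r (unif_discrete n (?x n)) \<mu> = enn2real (?P n) powr (1 / r)" if "n > 0" for n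
  proof -
    have "mean_power r n (?x n) = ?P n"
      unfolding mean_power_def
    proof (rule nn_integral_cong)
      fix t :: real
      show "ennreal ((real n * \<bar>?x n (nat \<lfloor>real n * t\<rfloor>) - Q t\<bar>) powr r) * indicator ?U t =
        ennreal ((real n * \<bar>Q ((2 * real (nat \<lfloor>real n * t\<rfloor>) + 1) / (2 * real n)) - Q t\<bar>) powr r) * indicator ?U t"
      proof (cases "t \<in> ?U")
        case True
        then have "nat \<lfloor>real n * t\<rfloor> < n" using that by (simp add: nat_less_iff floor_less_iff)
        from Q[OF mid[OF this]] show ?thesis by simp
      qed simp
    qed
    with kd[OF that xXi] show ?thesis by simp
  qed
  have upper: "real n * best_unif_dist r \<mu> n \<le> enn2real (?P n) powr (1 / r)" if "n > 0" for n
  proof -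
    have "best_unif_dist r \<mu> n \<le> kdist r (unif_discrete n (?x n)) \<mu>"
      unfolding best_unif_dist_def
      by (rule cINF_lower) (auto intro!: bdd_belowI2 kdist_nonneg xXi)
    then show ?thesis unfolding xP[OF that, symmetric] by (simp add: mult_left_mono)
  qed
  \<comment> \<open>The bound is uniform in x, so it survives the infimum.\<close>
  have lower: "enn2real (sym_mean_power r n) powr (1 / r) \<le> real n * best_unif_dist r \<mu> n" if n: "n > 0" for n
  proof -
    have "enn2real (sym_mean_power r n) powr (1 / r) / real n \<le> best_unif_dist r \<mu> n"
      unfolding best_unif_dist_def
    proof (rule cINF_greatest)
      show "Xi n \<noteq> {}" using xXi by blast
      fix x assume x: "x \<in> Xi n"
      have "enn2real (sym_mean_power r n) \<le> enn2real (mean_power r n x)"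
        using sym_mean_power_le_mean_power[OF r n] fin[OF n] by (intro enn2real_mono) auto
      then have "enn2real (sym_mean_power r n) powr (1 / r) \<le> real n * kdist r (unif_discrete n x) \<mu>"
        unfolding kd[OF n x] using r by (intro powr_mono2) auto
      then show "enn2real (sym_mean_power r n) powr (1 / r) / real n \<le> kdist r (unif_discrete n x) \<mu>"
        using n by (simp add: divide_le_eq mult.commute)
    qed
    then show ?thesis using n by (simp add: divide_le_eq mult.commute)
  qed
  have S_liminf: "ennreal c * g_power r \<le> liminf (sym_mean_power r)"
    unfolding c_def by (rule sym_mean_power_liminf[OF r])

  show ?thesis
  proof (cases "g_power r = \<infinity>")
    case True
    have "((\<lambda>n. ereal (real n * best_unif_dist r \<mu> n)) \<longlongrightarrow> \<infinity>) sequentially"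
      unfolding tendsto_PInfty
    proof
      fix y :: real
      \<comment> \<open>Chosen so that its r-th root is max y 0 + 1, which exceeds y.\<close>
      define z where "z = (max y 0 + 1) powr r"
      have "ennreal z < ennreal c * g_power r" using True c0 by (simp add: ennreal_mult_top)
      with S_liminf have "eventually (\<lambda>n. ennreal z < sym_mean_power r n) sequentially"
        by (auto simp: le_Liminf_iff)
      then show "eventually (\<lambda>n. ereal y < ereal (real n * best_unif_dist r \<mu> n)) sequentially"
        using eventually_gt_at_top[of 0]
      proof eventually_elim
        case (elim n)
        then have "ennreal z < ennreal (enn2real (sym_mean_power r n))" using S_fin[of n] by simp
        then have "z \<le> enn2real (sym_mean_power r n)" by (simp add: ennreal_less_iff z_def)
        then have "z powr (1 / r) \<le> enn2real (sym_mean_power r n) powr (1 / r)"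
          using r by (intro powr_mono2) (auto simp: z_def)
        moreover have "z powr (1 / r) = max y 0 + 1" using r by (simp add: z_def powr_powr)
        ultimately show ?case using lower[OF elim(2)] by simp
      qed
    qed
    \<comment> \<open>The second claim is vacuous here, finiteness being its premise.\<close>
    with True show ?thesis by (simp add: g_power_def Let_def)
  next
    case False
    then have fin_I: "g_power r < \<infinity>" by (simp add: less_top)
    define I where "I = enn2real (g_power r)"
    have I: "g_power r = ennreal I" "I \<ge> 0" using fin_I by (simp_all add: I_def)
    define K where "K = c * I"
    have K0: "K \<ge> 0" using c0 I by (simp add: K_def)
    have Plim: "(\<lambda>n. enn2real (?P n)) \<longlonglongrightarrow> K"
      unfolding K_def I_def c_def by (rule mean_power_midpoints_tendsto[OF r fin_I])
    have Slim: "(\<lambda>n. enn2real (sym_mean_power r n)) \<longlonglongrightarrow> K"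
    proof (rule order_tendstoI)
      fix y assume y: "y < K"
      show "eventually (\<lambda>n. y < enn2real (sym_mean_power r n)) sequentially"
      proof (cases "y < 0")
        case True
        then have "y < enn2real (sym_mean_power r n)" for n by (meson enn2real_nonneg less_le_trans)
        then show ?thesis by simp
      next
        case False
        with y have "ennreal y < ennreal c * g_power r"
          using c0 I by (simp add: K_def ennreal_mult[symmetric] ennreal_less_iff)
        with S_liminf have "eventually (\<lambda>n. ennreal y < sym_mean_power r n) sequentially"
          by (auto simp: le_Liminf_iff)
        then show ?thesis using eventually_gt_at_top[of 0]
        proof eventually_elim
          case (elim n)
          then have "ennreal y < ennreal (enn2real (sym_mean_power r n))" using S_fin[of n] by simp
          then show ?case using False by (simp add: ennreal_less_iff)
        qed
      qed
    next
      fix y assume "K < y"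
      from order_tendstoD(2)[OF Plim this] eventually_gt_at_top[of 0]
      show "eventually (\<lambda>n. enn2real (sym_mean_power r n) < y) sequentially"
      proof eventually_elim
        case (elim n)
        have "enn2real (sym_mean_power r n) \<le> enn2real (?P n)"
          using sym_mean_power_le_mean_power[OF r elim(2)] fin[OF elim(2)] by (intro enn2real_mono) auto
        with elim show ?case by linarith
      qed
    qed
    have Proot: "(\<lambda>n. enn2real (?P n) powr (1 / r)) \<longlonglongrightarrow> K powr (1 / r)"
      by (rule tendsto_powr'[OF Plim tendsto_const]) (use r in auto)
    have Sroot: "(\<lambda>n. enn2real (sym_mean_power r n) powr (1 / r)) \<longlonglongrightarrow> K powr (1 / r)"
      by (rule tendsto_powr'[OF Slim tendsto_const]) (use r in auto)
    have best: "(\<lambda>n. real n * best_unif_dist r \<mu> n) \<longlonglongrightarrow> K powr (1 / r)"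
      by (rule tendsto_sandwich[OF _ _ Sroot Proot])
        (auto intro!: eventually_mono[OF eventually_gt_at_top[of 0]] lower upper)
    have "K powr (1 / r) = 1 / (2 * (r + 1) powr (1 / r)) * I powr (1 / r)"
      using r I(2) by (simp add: K_def c_def powr_mult powr_divide powr_powr)
    with tendsto_ereal[OF best] False
    have first: "((\<lambda>n. ereal (real n * best_unif_dist r \<mu> n)) \<longlongrightarrow>
            (let I = (\<integral>\<^sup>+ t\<in>{0<..<1}. ennreal (g t powr r) \<partial>lborel)
             in if I = \<infinity> then \<infinity>
                else ereal (1 / (2 * (r + 1) powr (1 / r)) * enn2real I powr (1 / r)))) sequentially"
      unfolding g_power_def[symmetric] Let_def I_def[symmetric] by simp
    have second: "(\<lambda>n. kdist r (unif_discrete n (?x n)) \<mu> / best_unif_dist r \<mu> n) \<longlonglongrightarrow> 1"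
      if not_Dirac: "\<forall>a. \<mu> \<noteq> return borel a"
    proof -
      \<comment> \<open>The limit in the denominator must be positive. If I were 0, then g would
        vanish almost everywhere, the quantile would be constant and the measure a Dirac
        measure.\<close>
      have "I \<noteq> 0"
      proof
        assume "I = 0"
        then have "(\<integral>\<^sup>+t\<in>?U. ennreal (g t powr r) \<partial>lborel) = 0"
          using I(1) by (simp add: g_power_def)
        then have "AE t in lborel. ennreal (g t powr r) * indicator ?U t = 0"
          by (subst (asm) nn_integral_0_iff_AE) simp_all
        then have g0: "AE t in lborel. t \<in> ?U \<longrightarrow> g t = 0"
          by eventually_elim (auto simp: indicator_def)
        have const: "quantile \<mu> t = quantile \<mu> u" if "0 < t" "t < u" "u < 1" for t u
        proof -
          have "AE s in lborel. ennreal (g s) * indicator {t<..u} s = 0"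
            using g0 by eventually_elim (use that in \<open>auto simp: indicator_def\<close>)
          then have "ennreal (Q u - Q t) = 0"
            unfolding Q_increment[OF that] by (subst nn_integral_0_iff_AE) auto
          then show ?thesis using that quantile_mono[OF prob, of t u] by (simp add: Q ennreal_eq_0_iff)
        qed
        have "quantile \<mu> t = quantile \<mu> (1/2)" if "0 < t" "t < 1" for t
        proof (cases t "1/2 :: real" rule: linorder_cases)
          case less
          with that show ?thesis by (intro const) simp_all
        next
          case greater
          with that show ?thesis by (intro const[symmetric]) simp_all
        next
          case equal
          then show ?thesis by (rule arg_cong)
        qed
        from eq_return_of_quantile_const[OF prob this] not_Dirac show False by blast
      qed
      with I c0 have "K > 0" by (simp add: K_def)
      have "(\<lambda>n. enn2real (?P n) powr (1 / r) / (real n * best_unif_dist r \<mu> n)) \<longlonglongrightarrow> K powr (1 / r) / K powr (1 / r)"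
        using \<open>K > 0\<close> by (intro tendsto_divide Proot best) simp
      then have "(\<lambda>n. enn2real (?P n) powr (1 / r) / (real n * best_unif_dist r \<mu> n)) \<longlonglongrightarrow> 1"
        using \<open>K > 0\<close> by simp
      then show ?thesis
      proof (rule Lim_transform_eventually)
        \<comment> \<open>The factor n cancels between numerator and denominator.\<close>
        show "\<forall>\<^sub>F n in sequentially. enn2real (?P n) powr (1 / r) / (real n * best_unif_dist r \<mu> n)
          = kdist r (unif_discrete n (?x n)) \<mu> / best_unif_dist r \<mu> n"
          using eventually_gt_at_top[of 0] by eventually_elim (simp flip: xP)
      qed
    qed
    from first second show ?thesis by blast
  qed
qed

end
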